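(* Let $\Omega$ be a commutative semigroup. The species $\mathcal{RTF}$ of $\Omega$-typed labeled rooted trees, $A\mapsto \mathcal{RTF}(A)$, together with the partial compositions $$\circ_v:\mathcal{RTF}(A)\otimes\mathcal{RTF}(B)\to\mathcal{RTF}(A\sqcup B\setminus\{v\}),\qquad T\circ_v U:=\sum_{f:\mathrm{In}(v)\to V(U)}T\circ_v^f U ,\qquad v\in A,$$ is an operad.
   Context: $\mathbf{k}$ is a unitary commutative ring. For a finite set $A$, $T_\Omega(A)$ is the set of $\Omega$-typed $A$-labeled rooted trees: non-planar rooted trees whose vertices are labeled bijectively by the elements of $A$ (so the vertex set is $A$), with each edge given a type in $\Omega$. $\mathcal{RTF}(A)$ is the free $\mathbf{k}$-module on $T_\Omega(A)$ (bijections act by relabeling). For $T\in T_\Omega(A)$, $v\in A$, $\mathrm{In}(v)$ is the set of incoming edges of $v$ in $T$ (edges joining $v$ to its children). For $U\in T_\Omega(B)$ and $f:\mathrm{In}(v)\to V(U)$, the tree $T\circ_v^fU\in T_\Omega(A\sqcup B\setminus\{v\})$ is obtained by: replacing the vertex $v$ of $T$ by the tree $U$ (the edge leaving $v$ towards the root of $T$, if any, is attached to the root of $U$ with the same type); attaching each edge $a\in\mathrm{In}(v)$ to the vertex $f(a)$ of $U$, keeping its type; and, for each $a\in\mathrm{In}(v)$, multiplying by $\omega_a$ (the type of $a$) the type of every edge of $U$ below $f(a)$ (on the path from $f(a)$ to the root of $U$). All other types are unchanged. Operad: a species $\mathcal{P}$ (a contravariant functor from finite sets with bijections to $\mathbf{k}$-modules)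 with partial compositions $\circ_a:\mathcal{P}(A)\otimes\mathcal{P}(B)\to\mathcal{P}(A\sqcup B\setminus\{a\})$, $a\in A$, compatible with bijections, satisfying for $\lambda\in\mathcal P(A)$, $\mu\in\mathcal P(B)$, $\nu\in\mathcal P(C)$: (I) $(\lambda\circ_a\mu)\circ_b\nu=\lambda\circ_a(\mu\circ_b\nu)$ for $a\in A$, $b\in B$; (II) $(\lambda\circ_a\mu)\circ_{a'}\nu=(\lambda\circ_{a'}\nu)\circ_a\mu$ for distinct $a,a'\in A$; (III) there is a unit $\mathrm{id}\in\mathcal P(\{*\})$ with $\mathrm{id}\circ_*\mu=\mu$ and $\mu\circ_b\mathrm{id}=\mu$ (up to the canonical relabeling) for $b\in B$. For $\mathcal{RTF}$ the unit is the one-vertex tree. *)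

theory Defs
  imports Main "HOL-Library.FuncSet" "HOL-Library.Poly_Mapping"
begin

(* The library's locale module lives over comm_ring_1, whose axioms include 0 ~= 1; the sort
   {comm_ring, comm_monoid_mult} is that of an arbitrary unital commutative ring. The carrier M is
   a set, so that one ambient abelian group can host the modules P A for all A. *)
locale module_carrier =
  fixes scale :: "'k::{comm_ring,comm_monoid_mult} \<Rightarrow> 'm::ab_group_add \<Rightarrow> 'm"
    and M :: "'m set"
  assumes zero_closed: "0 \<in> M"
    and add_closed: "x \<in> M \<Longrightarrow> y \<in> M \<Longrightarrow> x + y \<in> M"
    and scale_closed: "x \<in> M \<Longrightarrow> scale r x \<in> M"
    and scale_right_distrib: "x \<in> M \<Longrightarrow> y \<in> M \<Longrightarrow> scale r (x + y) = scale r x + scale r y"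
    and scale_left_distrib: "x \<in> M \<Longrightarrow> scale (r + s) x = scale r x + scale s x"
    and scale_scale: "x \<in> M \<Longrightarrow> scale r (scale s x) = scale (r * s) x"
    and scale_one: "x \<in> M \<Longrightarrow> scale 1 x = x"

(* Finite sets are the finite subsets of the type 'a. A bijection s : A -> B acts contravariantly,
   act A s : P B -> P A; act_cong says that only the restriction of s to A matters. *)
locale species =
  fixes scale :: "'k::{comm_ring,comm_monoid_mult} \<Rightarrow> 'm::ab_group_add \<Rightarrow> 'm"
    and P :: "'a set \<Rightarrow> 'm set"
    and act :: "'a set \<Rightarrow> ('a \<Rightarrow> 'a) \<Rightarrow> 'm \<Rightarrow> 'm"
  assumes module_P: "finite A \<Longrightarrow> module_carrier scale (P A)"
    and act_closed: "\<lbrakk>finite A; bij_betw s A B; x \<in> P B\<rbrakk> \<Longrightarrow> act A s x \<in> P A"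
    and act_add: "\<lbrakk>finite A; bij_betw s A B; x \<in> P B; y \<in> P B\<rbrakk>
      \<Longrightarrow> act A s (x + y) = act A s x + act A s y"
    and act_scale: "\<lbrakk>finite A; bij_betw s A B; x \<in> P B\<rbrakk> \<Longrightarrow> act A s (scale r x) = scale r (act A s x)"
    and act_cong: "\<lbrakk>finite A; bij_betw s A B; \<And>z. z \<in> A \<Longrightarrow> s z = s' z; x \<in> P B\<rbrakk>
      \<Longrightarrow> act A s x = act A s' x"
    and act_id: "\<lbrakk>finite A; x \<in> P A\<rbrakk> \<Longrightarrow> act A id x = x"
    and act_comp: "\<lbrakk>finite A; bij_betw s A B; bij_betw t B C; x \<in> P C\<rbrakk>
      \<Longrightarrow> act A (t \<circ> s) x = act A s (act B t x)"

(* The disjoint union of A - {a} and B; only used under the hypothesis disjnt (A - {a}) B. *)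
abbreviation insertion :: "'a set \<Rightarrow> 'a \<Rightarrow> 'a set \<Rightarrow> 'a set" where
  "insertion A a B \<equiv> (A - {a}) \<union> B"

(* comp A a B : P A x P B -> P (insertion A a B) is the bilinear map corresponding to the linear
   partial composition on the tensor product. The label * of the unit is not a fixed element of 'a:
   unit x is the copy of id in P {x}, and unit_act says that these copies correspond to each other
   under the bijections {x} -> {y}. *)
locale operad = species scale P act
  for scale :: "'k::{comm_ring,comm_monoid_mult} \<Rightarrow> 'm::ab_group_add \<Rightarrow> 'm"
    and P :: "'a set \<Rightarrow> 'm set"
    and act :: "'a set \<Rightarrow> ('a \<Rightarrow> 'a) \<Rightarrow> 'm \<Rightarrow> 'm" +
  fixes comp :: "'a set \<Rightarrow> 'a \<Rightarrow> 'a set \<Rightarrow> 'm \<Rightarrow> 'm \<Rightarrow> 'm"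
    and unit :: "'a \<Rightarrow> 'm"
  assumes comp_closed:
      "\<lbrakk>finite A; finite B; a \<in> A; disjnt (A - {a}) B; x \<in> P A; y \<in> P B\<rbrakk>
       \<Longrightarrow> comp A a B x y \<in> P (insertion A a B)"
    and comp_add_left:
      "\<lbrakk>finite A; finite B; a \<in> A; disjnt (A - {a}) B; x \<in> P A; x' \<in> P A; y \<in> P B\<rbrakk>
       \<Longrightarrow> comp A a B (x + x') y = comp A a B x y + comp A a B x' y"
    and comp_add_right:
      "\<lbrakk>finite A; finite B; a \<in> A; disjnt (A - {a}) B; x \<in> P A; y \<in> P B; y' \<in> P B\<rbrakk>
       \<Longrightarrow> comp A a B x (y + y') = comp A a B x y + comp A a B x y'"
    and comp_scale_left:
      "\<lbrakk>finite A; finite B; a \<in> A; disjnt (A - {a}) B; x \<in> P A; y \<in> P B\<rbrakk>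
       \<Longrightarrow> comp A a B (scale r x) y = scale r (comp A a B x y)"
    and comp_scale_right:
      "\<lbrakk>finite A; finite B; a \<in> A; disjnt (A - {a}) B; x \<in> P A; y \<in> P B\<rbrakk>
       \<Longrightarrow> comp A a B x (scale r y) = scale r (comp A a B x y)"
    and comp_act:
      "\<lbrakk>finite A; finite B; a \<in> A; disjnt (A - {a}) B;
        bij_betw s A A'; bij_betw t B B'; disjnt (A' - {s a}) B'; x \<in> P A'; y \<in> P B'\<rbrakk>
       \<Longrightarrow> act (insertion A a B) (\<lambda>z. if z \<in> B then t z else s z) (comp A' (s a) B' x y)
           = comp A a B (act A s x) (act B t y)"
    and comp_assoc_nested:
      "\<lbrakk>finite A; finite B; finite C; a \<in> A; b \<in> B;
        disjnt (A - {a}) B; disjnt (A - {a}) C; disjnt (B - {b}) C;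
        x \<in> P A; y \<in> P B; z \<in> P C\<rbrakk>
       \<Longrightarrow> comp (insertion A a B) b C (comp A a B x y) z
           = comp A a (insertion B b C) x (comp B b C y z)"
    and comp_assoc_parallel:
      "\<lbrakk>finite A; finite B; finite C; a \<in> A; a' \<in> A; a \<noteq> a';
        disjnt (A - {a}) B; disjnt (A - {a'}) C; disjnt B C;
        x \<in> P A; y \<in> P B; z \<in> P C\<rbrakk>
       \<Longrightarrow> comp (insertion A a B) a' C (comp A a B x y) z
           = comp (insertion A a' C) a B (comp A a' C x z) y"
    and unit_closed: "unit v \<in> P {v}"
    and unit_act: "act {v} (\<lambda>_. w) (unit w) = unit v"
    and unit_left: "\<lbrakk>finite B; y \<in> P B\<rbrakk> \<Longrightarrow> comp {v} v B (unit v) y = y"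
    and unit_right: "\<lbrakk>finite B; b \<in> B; disjnt (B - {b}) {v}; y \<in> P B\<rbrakk>
       \<Longrightarrow> comp B b {v} y (unit v) = act (insertion B b {v}) (\<lambda>z. if z = v then b else z) y"

(* par x = Some (p, w) means that p is the parent of x and that the edge between them has type w;
   par is None at the root and outside the vertex set. *)
datatype ('a, 'w) ttree = TTree (root: 'a) (par: "'a \<Rightarrow> ('a \<times> 'w) option")

definition par_rel :: "('a, 'w) ttree \<Rightarrow> ('a \<times> 'a) set" where
  "par_rel T = {(x, p). \<exists>w. par T x = Some (p, w)}"

definition verts :: "('a, 'w) ttree \<Rightarrow> 'a set" where
  "verts T = insert (root T) (dom (par T))"

definition ttrees :: "'a set \<Rightarrow> ('a, 'w) ttree set" where
  "ttrees A = {T. root T \<in> A \<and> dom (par T) = A - {root T} \<and> par_rel T \<subseteq> A \<times> A \<and>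
     (\<forall>x\<in>A. (x, root T) \<in> (par_rel T)\<^sup>*)}"

(* An edge is identified with its end farther from the root: the set of children of v is In(v). *)
definition in_edges :: "('a, 'w) ttree \<Rightarrow> 'a \<Rightarrow> 'a set" where
  "in_edges T v = {x. (x, v) \<in> par_rel T}"

definition edge_type :: "('a, 'w) ttree \<Rightarrow> 'a \<Rightarrow> 'w" where
  "edge_type T x = snd (the (par T x))"

(* The edge of U leaving x lies on the path from f a to the root of U iff (f a, x) is in the
   reflexive transitive closure of par_rel U. A fold is used since a semigroup need not have a
   neutral element. *)
definition graft ::
  "'a \<Rightarrow> ('a \<Rightarrow> 'a) \<Rightarrow> ('a, 'w::ab_semigroup_mult) ttree \<Rightarrow> ('a, 'w) ttree \<Rightarrow> ('a, 'w) ttree" where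
  "graft v f T U = TTree
     (if root T = v then root U else root T)
     (\<lambda>x. if x \<in> verts U then
            (if x = root U then par T v
             else map_option
               (\<lambda>(p, w). (p, Finite_Set.fold (\<lambda>a. (*) (edge_type T a)) w
                               {a \<in> in_edges T v. (f a, x) \<in> (par_rel U)\<^sup>*}))
               (par U x))
          else if x = v then None
          else map_option (\<lambda>(p, w). (if p = v then f x else p, w)) (par T x))"

(* Pulling back along the bijection s from A: the vertex s x becomes x. *)
definition relabel :: "'a set \<Rightarrow> ('a \<Rightarrow> 'a) \<Rightarrow> ('a, 'w) ttree \<Rightarrow> ('a, 'w) ttree" where
  "relabel A s T = TTree (inv_into A s (root T))
     (\<lambda>x. if x \<in> A then map_option (\<lambda>(p, w). (inv_into A s p, w)) (par T (s x)) else None)"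

definition RTF :: "'a set \<Rightarrow> (('a, 'w) ttree \<Rightarrow>\<^sub>0 'k::{comm_ring,comm_monoid_mult}) set" where
  "RTF A = {c. Poly_Mapping.keys c \<subseteq> ttrees A}"

definition RTF_scale ::
  "'k::{comm_ring,comm_monoid_mult} \<Rightarrow> (('a, 'w) ttree \<Rightarrow>\<^sub>0 'k) \<Rightarrow> (('a, 'w) ttree \<Rightarrow>\<^sub>0 'k)" where
  "RTF_scale r c = Poly_Mapping.map ((*) r) c"

definition RTF_act ::
  "'a set \<Rightarrow> ('a \<Rightarrow> 'a) \<Rightarrow> (('a, 'w) ttree \<Rightarrow>\<^sub>0 'k::{comm_ring,comm_monoid_mult}) \<Rightarrow>
   (('a, 'w) ttree \<Rightarrow>\<^sub>0 'k)" where
  "RTF_act A s c = (\<Sum>T\<in>Poly_Mapping.keys c. Poly_Mapping.single (relabel A s T) (Poly_Mapping.lookup c T))"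

definition tree_comp ::
  "'a \<Rightarrow> ('a, 'w::ab_semigroup_mult) ttree \<Rightarrow> ('a, 'w) ttree \<Rightarrow>
   (('a, 'w) ttree \<Rightarrow>\<^sub>0 'k::{comm_ring,comm_monoid_mult})" where
  "tree_comp v T U =
     (\<Sum>f \<in> in_edges T v \<rightarrow>\<^sub>E verts U. Poly_Mapping.single (graft v f T U) 1)"

definition RTF_comp ::
  "'a \<Rightarrow> (('a, 'w::ab_semigroup_mult) ttree \<Rightarrow>\<^sub>0 'k::{comm_ring,comm_monoid_mult}) \<Rightarrow>
   (('a, 'w) ttree \<Rightarrow>\<^sub>0 'k) \<Rightarrow> (('a, 'w) ttree \<Rightarrow>\<^sub>0 'k)" where
  "RTF_comp v c d =
     (\<Sum>T\<in>Poly_Mapping.keys c. \<Sum>U\<in>Poly_Mapping.keys d. RTF_scale (Poly_Mapping.lookup c T * Poly_Mapping.lookup d U) (tree_comp v T U))"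

definition RTF_unit :: "'a \<Rightarrow> (('a, 'w) ttree \<Rightarrow>\<^sub>0 'k::{comm_ring,comm_monoid_mult})" where
  "RTF_unit v = Poly_Mapping.single (TTree v (\<lambda>_. None)) 1"

end

theory Submission
  imports Defs
begin

text \<open>
  Both associativity laws already hold tree by tree: the composite trees on the two sides are
  indexed by attachment maps, and a bijection between these indices makes corresponding trees equal.
  For nested composition, a pair \<open>(f, g)\<close> with \<open>f : In(a) \<rightarrow> V(U)\<close>
  and \<open>g\<close> defined on the edges entering \<open>b\<close> in the composite of \<open>T\<close> and \<open>U\<close>
  corresponds to \<open>(h, k)\<close>, where \<open>h\<close> is the restriction of \<open>g\<close> to the edges of \<open>U\<close> and
  \<open>k\<close> is \<open>f\<close> followed by \<open>g\<close> on the edges that \<open>f\<close> sends to \<open>b\<close>.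
  Equality of the types reduces to the description of the tree order of a composite, together with
  the commutativity of \<open>\<Omega>\<close>, which lets the factors contributed by the grafted edges be collected in
  any order.
\<close>

section \<open>Typed rooted trees and grafting\<close>

text \<open>Trees are compared through their parent functions, vertex by vertex, and two features of
  the encoding shape this. An edge is named by its upper end, so insertion at a vertex renames the
  edge leaving it: if \<open>a'\<close> is a child of \<open>a\<close>, inserting \<open>V\<close>
  at \<open>a'\<close> turns the edge \<open>a'\<close> of In(\<open>a\<close>) into
  \<open>root V\<close>. The two orders of parallel insertion thus use attachment maps on different
  sets, matched by this renaming. Moreover only \<open>A - {a}\<close> has to be disjoint from
  \<open>B\<close>, so the removed label \<open>a\<close> may occur again in \<open>B\<close>;
  membership in \<open>B\<close> is tested before comparison with \<open>a\<close>. As for types, an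
  edge \<open>d\<close> of \<open>T\<close> can contribute to an edge of \<open>V\<close> directly
  or by way of an edge of \<open>U\<close> entering \<open>b\<close>. It must count exactly once:
  the vertices below a given vertex form a chain, so \<open>d\<close> lies above at most one edge
  entering \<open>b\<close>, and above none if it is itself attached to \<open>b\<close>. A
  semigroup has no empty product, so each product of types is carried as an action
  \<open>acc\<close> on a starting type.\<close>

abbreviation acc :: "('a \<Rightarrow> 'w::ab_semigroup_mult) \<Rightarrow> 'a set \<Rightarrow> 'w \<Rightarrow> 'w" where
  "acc t S w \<equiv> Finite_Set.fold (\<lambda>a. (*) (t a)) w S"

lemma acc_insert:
  assumes "finite S" "a \<notin> S"
  shows "acc t (insert a S) w = t a * acc t S w"
proof -
  interpret comp_fun_commute "\<lambda>a. (*) (t a)"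
    by standard (simp add: fun_eq_iff mult.left_commute)
  show ?thesis using assms by simp
qed

lemma acc_mult: "finite S \<Longrightarrow> acc t S (u * w) = u * acc t S w"
  by (induction S rule: finite_induct) (simp_all add: acc_insert mult.left_commute)

lemma acc_cong:
  assumes "finite S" "\<And>a. a \<in> S \<Longrightarrow> t a = t' a"
  shows "acc t S w = acc t' S w"
  using assms by (induction S rule: finite_induct) (simp_all add: acc_insert)

lemma acc_Un:
  assumes "finite S" "finite S'" "S \<inter> S' = {}"
  shows "acc t (S \<union> S') w = acc t S (acc t S' w)"
  using assms by (induction S rule: finite_induct) (simp_all add: acc_insert)

lemma acc_commute:
  assumes "finite S" "finite S'"
  shows "acc t S (acc t' S' w) = acc t' S' (acc t S w)"
  using assms by (induction S rule: finite_induct) (simp_all add: acc_insert acc_mult)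

lemma acc_image:
  assumes "finite S" "inj_on g S"
  shows "acc t (g ` S) w = acc (t \<circ> g) S w"
  using assms by (induction S rule: finite_induct) (simp_all add: acc_insert)

text \<open>Flattens a product of products. It is applied with \<open>S\<close> a set of edges of
  \<open>U\<close> entering \<open>b\<close> and \<open>D c\<close> the edges of \<open>T\<close>
  grafted above \<open>c\<close>: each type \<open>u c\<close> already carries the factors from
  \<open>D c\<close>, and disjointness ensures that no factor is lost in the union.\<close>

lemma acc_UNION:
  assumes "finite S" "\<And>c. c \<in> S \<Longrightarrow> finite (D c)"
    and "\<And>c c'. c \<in> S \<Longrightarrow> c' \<in> S \<Longrightarrow> c \<noteq> c' \<Longrightarrow> D c \<inter> D c' = {}"
  shows "acc (\<lambda>c. acc t (D c) (u c)) S w = acc t (\<Union>c\<in>S. D c) (acc u S w)"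
  using assms
proof (induction S rule: finite_induct)
  case (insert c S)
  have "acc t (\<Union>c\<in>insert c S. D c) (acc u (insert c S) w)
      = acc t (D c \<union> (\<Union>c\<in>S. D c)) (u c * acc u S w)"
    using insert.hyps by (simp add: acc_insert)
  also have "\<dots> = acc t (D c) (acc t (\<Union>c\<in>S. D c) (u c * acc u S w))"
  proof (rule acc_Un)
    show "D c \<inter> (\<Union>c\<in>S. D c) = {}"
      using insert.hyps(2) insert.prems(2)[of c] by blast
  qed (use insert in auto)
  also have "\<dots> = acc t (D c) (acc t (\<Union>c\<in>S. D c) (acc u S w) * u c)"
    using insert.hyps insert.prems by (subst acc_mult) (simp_all add: mult.commute)
  also have "\<dots> = acc t (D c) (u c) * acc t (\<Union>c\<in>S. D c) (acc u S w)"
    using insert.prems by (subst acc_mult) (simp_all add: mult.commute)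
  finally show ?case
    using insert by (simp add: acc_insert)
qed simp

section \<open>Parents, the tree order and its chains\<close>

lemma single_valued_par_rel: "single_valued (par_rel T)"
  by (auto simp: single_valued_def par_rel_def)

lemma verts_ttrees: "T \<in> ttrees A \<Longrightarrow> verts T = A"
  by (auto simp: ttrees_def verts_def)

lemma root_in: "T \<in> ttrees A \<Longrightarrow> root T \<in> A"
  by (simp add: ttrees_def)

lemma par_root [simp]: "T \<in> ttrees A \<Longrightarrow> par T (root T) = None"
  by (auto simp: ttrees_def)

lemma par_outside: "T \<in> ttrees A \<Longrightarrow> x \<notin> A \<Longrightarrow> par T x = None"
  by (auto simp: ttrees_def)

lemma par_Some_ex:
  assumes "T \<in> ttrees A" "x \<in> A" "x \<noteq> root T"
  obtains p w where "par T x = Some (p, w)"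
proof -
  have "x \<in> dom (par T)" using assms by (simp add: ttrees_def)
  then show thesis using that by auto
qed

lemma par_relI: "par T x = Some (p, w) \<Longrightarrow> (x, p) \<in> par_rel T"
  by (auto simp: par_rel_def)

lemma par_rel_in: "T \<in> ttrees A \<Longrightarrow> (x, y) \<in> par_rel T \<Longrightarrow> x \<in> A \<and> y \<in> A \<and> x \<noteq> root T"
  by (auto simp: ttrees_def par_rel_def)

lemma root_reachable: "T \<in> ttrees A \<Longrightarrow> x \<in> A \<Longrightarrow> (x, root T) \<in> (par_rel T)\<^sup>*"
  by (simp add: ttrees_def)

text \<open>Parents are unique, so a vertex on a cycle would reach only vertices having a parent,
  and never the root.\<close>

lemma acyclic_par_rel:
  assumes "T \<in> ttrees A"
  shows "acyclic (par_rel T)"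
  unfolding acyclic_def
proof (intro allI notI)
  fix x assume cyc: "(x, x) \<in> (par_rel T)\<^sup>+"
  have "(y, x) \<in> (par_rel T)\<^sup>+" if "(x, y) \<in> (par_rel T)\<^sup>*" for y
    using that
  proof (induction rule: rtrancl_induct)
    case (step y z)
    from step.IH obtain z' where "(y, z') \<in> par_rel T" "(z', x) \<in> (par_rel T)\<^sup>*"
      by (blast dest: tranclD)
    then have "(z, x) \<in> (par_rel T)\<^sup>*"
      using step.hyps(2) single_valued_par_rel by (metis single_valuedD)
    then show ?case using cyc by simp
  qed (rule cyc)
  moreover have "x \<in> A" using cyc assms by (blast dest: tranclD par_rel_in)
  ultimately have "(root T, x) \<in> (par_rel T)\<^sup>+"
    using assms by (simp add: root_reachable)
  then obtain z where "(root T, z) \<in> par_rel T" by (blast dest: tranclD)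
  then show False using par_rel_in[OF assms] by blast
qed

lemma in_edges_subset: "T \<in> ttrees A \<Longrightarrow> in_edges T v \<subseteq> A - {v}"
  using acyclic_par_rel[of T A] par_rel_in[of T A]
  by (auto simp: in_edges_def acyclic_def)

lemma finite_in_edges: "finite A \<Longrightarrow> T \<in> ttrees A \<Longrightarrow> finite (in_edges T v)"
  using in_edges_subset by (metis finite_Diff finite_subset)

text \<open>Since parents are unique, the vertices below \<open>x\<close> form a chain, so
  \<open>c\<close> and \<open>c'\<close> are comparable. A nontrivial path from one to the other
  starts with the step to \<open>v\<close>, and the edge from the other back to \<open>v\<close>
  closes a cycle.\<close>

lemma siblings_disjoint:
  assumes T: "T \<in> ttrees A" and c: "c \<in> in_edges T v" and c': "c' \<in> in_edges T v"
    and x: "(x, c) \<in> (par_rel T)\<^sup>*" "(x, c') \<in> (par_rel T)\<^sup>*"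
  shows "c = c'"
proof (rule ccontr)
  have *: False if e: "e \<in> in_edges T v" "e' \<in> in_edges T v" "e \<noteq> e'" "(e, e') \<in> (par_rel T)\<^sup>*" for e e'
  proof -
    obtain z where "(e, z) \<in> par_rel T" "(z, e') \<in> (par_rel T)\<^sup>*"
      using e(3,4) by (meson converse_rtranclE)
    moreover have "(e, v) \<in> par_rel T" "(e', v) \<in> par_rel T"
      using e(1,2) by (auto simp: in_edges_def)
    ultimately have "(v, v) \<in> (par_rel T)\<^sup>+"
      using single_valued_par_rel by (metis single_valuedD rtrancl_into_trancl1)
    then show False using acyclic_par_rel[OF T] by (auto simp: acyclic_def)
  qed
  assume "c \<noteq> c'"
  moreover have "(c, c') \<in> (par_rel T)\<^sup>* \<or> (c', c) \<in> (par_rel T)\<^sup>*"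
    using single_valued_confluent[OF single_valued_par_rel] x by metis
  ultimately show False using * c c' by metis
qed

section \<open>Order, incoming edges and types of a grafted tree\<close>

locale grafting =
  fixes A B :: "'a set" and v :: 'a and f :: "'a \<Rightarrow> 'a"
    and T U :: "('a, 'w::ab_semigroup_mult) ttree"
  assumes T: "T \<in> ttrees A" and U: "U \<in> ttrees B" and v: "v \<in> A"
    and disj: "disjnt (A - {v}) B" and f: "\<And>x. x \<in> in_edges T v \<Longrightarrow> f x \<in> B"
begin

abbreviation "G \<equiv> graft v f T U"

text \<open>The exception \<open>x = v\<close> is genuine: the label \<open>v\<close> is removed
  from \<open>T\<close> but may be the label of a vertex of \<open>U\<close>.\<close>

lemma notin_B: "x \<in> A \<Longrightarrow> x \<noteq> v \<Longrightarrow> x \<notin> B"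
  using disj by (auto simp: disjnt_def)

lemma root_G: "root G = (if root T = v then root U else root T)"
  by (simp add: graft_def)

lemma par_root_U: "par G (root U) = par T v"
  using root_in[OF U] by (simp add: graft_def verts_ttrees[OF U])

lemma par_U:
  "par U x = Some (p, w) \<Longrightarrow>
    par G x = Some (p, acc (edge_type T) {a \<in> in_edges T v. (f a, x) \<in> (par_rel U)\<^sup>*} w)"
  using par_rel_in[OF U par_relI] by (auto simp: graft_def verts_ttrees[OF U])

lemma par_T:
  "x \<notin> B \<Longrightarrow> x \<noteq> v \<Longrightarrow> par G x = map_option (\<lambda>(p, w). (if p = v then f x else p, w)) (par T x)"
  by (simp add: graft_def verts_ttrees[OF U])

lemma par_v: "v \<notin> B \<Longrightarrow> par G v = None"
  by (simp add: graft_def verts_ttrees[OF U])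

lemma not_par_rel_v_v: "(v, v) \<notin> par_rel T"
  using acyclic_par_rel[OF T] by (auto simp: acyclic_def)

text \<open>Among the vertices of \<open>U\<close> only the root can acquire a parent, namely the
  former parent of \<open>v\<close>.\<close>

lemma par_rel_G_B:
  "x \<in> B \<Longrightarrow> (x, y) \<in> par_rel G \<longleftrightarrow> (x, y) \<in> par_rel U \<or> x = root U \<and> (v, y) \<in> par_rel T"
proof (cases "x = root U")
  case True
  then show ?thesis using par_rel_in[OF U, of x y] by (auto simp: par_rel_def par_root_U)
next
  case False
  assume "x \<in> B"
  with False obtain p w where "par U x = Some (p, w)" by (blast elim: par_Some_ex[OF U])
  then show ?thesis using False by (auto simp: par_rel_def par_U)
qed

lemma par_rel_G_notB:
  "x \<notin> B \<Longrightarrow> (x, y) \<in> par_rel G \<longleftrightarrow>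
     x \<noteq> v \<and> ((x, y) \<in> par_rel T \<and> y \<noteq> v \<or> (x, v) \<in> par_rel T \<and> y = f x)"
  using f[of x]
  by (cases "x = v"; cases "par T x") (auto simp: par_rel_def par_v par_T in_edges_def split: if_splits)

lemma par_rel_G_in: "(x, y) \<in> par_rel G \<Longrightarrow> x \<in> insertion A v B \<and> y \<in> insertion A v B"
  using par_rel_in[OF T, of x y] par_rel_in[OF T, of v y] par_rel_in[OF U, of x y] f[of x]
    not_par_rel_v_v par_rel_in[OF T, of x v]
  by (cases "x \<in> B") (auto simp: par_rel_G_B par_rel_G_notB in_edges_def root_in[OF U])

lemma reach_U: "(x, y) \<in> (par_rel U)\<^sup>* \<Longrightarrow> (x, y) \<in> (par_rel G)\<^sup>*"
proof (rule rtrancl_mono[THEN subsetD])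
  show "par_rel U \<subseteq> par_rel G"
    using par_rel_G_B par_rel_in[OF U] by auto
qed

text \<open>Contracting \<open>B\<close> to \<open>v\<close> maps \<open>G\<close> onto
  \<open>T\<close>, and \<open>x\<close> is the image of \<open>x'\<close>; a path of
  \<open>T\<close> is lifted along this contraction. A step into \<open>v\<close> lifts to a step to
  \<open>f x'\<close>, and a step out of \<open>v\<close> is preceded by the descent inside
  \<open>U\<close> to \<open>root U\<close>. The end \<open>y\<close> must differ from
  \<open>v\<close> because its lift has to be a single vertex.\<close>

lemma reach_T:
  assumes "(x, y) \<in> (par_rel T)\<^sup>*" "y \<noteq> v" "x' \<in> insertion A v B" "x = (if x' \<in> B then v else x')"
  shows "(x', y) \<in> (par_rel G)\<^sup>*"
  using assms
proof (induction arbitrary: x' rule: converse_rtrancl_induct)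
  case base
  then show ?case by (auto split: if_splits)
next
  case (step x z)
  show ?case
  proof (cases "x' \<in> B")
    case True
    then have "(v, z) \<in> par_rel T" using step by simp
    then have z: "z \<in> A" "z \<noteq> v" using not_par_rel_v_v par_rel_in[OF T] by auto
    then have "(z, y) \<in> (par_rel G)\<^sup>*" using step notin_B by auto
    moreover have "(root U, z) \<in> par_rel G"
      using \<open>(v, z) \<in> par_rel T\<close> par_rel_G_B root_in[OF U] by auto
    moreover have "(x', root U) \<in> (par_rel G)\<^sup>*"
      using True reach_U root_reachable[OF U] by auto
    ultimately show ?thesis by (meson rtrancl_trans converse_rtrancl_into_rtrancl)
  next
    case False
    then have x': "x' = x" "x' \<noteq> v" "x' \<in> A" using step.prems by auto
    have z: "z \<in> A" using step.hyps par_rel_in[OF T] by auto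
    let ?z = "if z = v then f x' else z"
    have "?z \<in> insertion A v B" "z = (if ?z \<in> B then v else ?z)"
      using z f[of x'] notin_B step.hyps(1) x' by (auto simp: in_edges_def)
    then have "(?z, y) \<in> (par_rel G)\<^sup>*" using step.IH step.prems by blast
    moreover have "(x', ?z) \<in> par_rel G"
      using False x' step.hyps(1) by (auto simp: par_rel_G_notB)
    ultimately show ?thesis by (meson converse_rtrancl_into_rtrancl)
  qed
qed

text \<open>The invariant for following a path in \<open>G\<close> from a fixed start. It must treat
  ends inside and outside \<open>B\<close> together, since a path from outside may enter
  \<open>B\<close> through an edge \<open>c\<close> and leave it again through
  \<open>root U\<close>. The exact descriptions of the order below are read off from it.\<close>

lemma reach_G_aux:
  assumes "(x, y) \<in> (par_rel G)\<^sup>*" "x \<in> insertion A v B"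
  shows "if y \<in> B then (if x \<in> B then (x, y) \<in> (par_rel U)\<^sup>*
             else \<exists>c\<in>in_edges T v. (x, c) \<in> (par_rel T)\<^sup>* \<and> (f c, y) \<in> (par_rel U)\<^sup>*)
         else y \<noteq> v \<and> ((if x \<in> B then v else x), y) \<in> (par_rel T)\<^sup>*"
  using assms
proof (induction rule: rtrancl_induct)
  case base
  then show ?case by auto
next
  case (step y z)
  note IH = step.IH[OF step.prems]
  show ?case
  proof (cases "y \<in> B")
    case yB: True
    then consider "(y, z) \<in> par_rel U" | "y = root U" "(v, z) \<in> par_rel T"
      using step.hyps(2) par_rel_G_B by blast
    then show ?thesis
    proof cases
      case 1
      moreover have "z \<in> B" using 1 par_rel_in[OF U] by auto
      ultimately show ?thesis using IH yB by (force split: if_splits intro: rtrancl_into_rtrancl)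
    next
      case 2
      then have z: "z \<in> A" "z \<noteq> v" "z \<notin> B"
        using not_par_rel_v_v par_rel_in[OF T] notin_B by auto
      have "(if x \<in> B then v else x, v) \<in> (par_rel T)\<^sup>*"
        using IH yB by (auto simp: in_edges_def intro: rtrancl_into_rtrancl)
      then show ?thesis using 2 z by (auto intro: rtrancl_into_rtrancl)
    qed
  next
    case yB: False
    then consider "(y, z) \<in> par_rel T" "z \<noteq> v" | "(y, v) \<in> par_rel T" "z = f y"
      using step.hyps(2) par_rel_G_notB by blast
    then show ?thesis
    proof cases
      case 1
      then have "z \<notin> B" using par_rel_in[OF T] notin_B by auto
      then show ?thesis using 1 IH yB by (auto intro: rtrancl_into_rtrancl)
    next
      case 2
      then have y: "y \<in> in_edges T v" by (simp add: in_edges_def)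
      \<comment> \<open>A path that starts in \<open>B\<close>, leaves it and returns through
        \<open>y\<close> would contract to a cycle through \<open>v\<close> in
        \<open>T\<close>.\<close>
      have "x \<notin> B"
      proof
        assume "x \<in> B"
        then have "(v, y) \<in> (par_rel T)\<^sup>*" using IH yB by auto
        then have "(v, v) \<in> (par_rel T)\<^sup>+" using 2(1) by auto
        then show False using acyclic_par_rel[OF T] by (auto simp: acyclic_def)
      qed
      then show ?thesis using 2 y f IH yB by auto
    qed
  qed
qed

lemma reach_G_BB:
  "x \<in> B \<Longrightarrow> y \<in> B \<Longrightarrow> (x, y) \<in> (par_rel G)\<^sup>* \<longleftrightarrow> (x, y) \<in> (par_rel U)\<^sup>*"
  using reach_G_aux[of x y] reach_U by auto

lemma reach_G_AB:
  assumes "x \<in> A - {v}" "y \<in> B"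
  shows "(x, y) \<in> (par_rel G)\<^sup>* \<longleftrightarrow>
    (\<exists>c\<in>in_edges T v. (x, c) \<in> (par_rel T)\<^sup>* \<and> (f c, y) \<in> (par_rel U)\<^sup>*)" (is "_ \<longleftrightarrow> ?R")
proof
  assume "(x, y) \<in> (par_rel G)\<^sup>*"
  then show ?R using reach_G_aux[of x y] assms notin_B by auto
next
  assume ?R
  then obtain c where c: "c \<in> in_edges T v" "(x, c) \<in> (par_rel T)\<^sup>*" "(f c, y) \<in> (par_rel U)\<^sup>*" by blast
  then have cA: "c \<in> A" "c \<noteq> v" using in_edges_subset[OF T] by auto
  then have "(x, c) \<in> (par_rel G)\<^sup>*"
    using reach_T[OF c(2)] assms notin_B by auto
  moreover have "(c, f c) \<in> par_rel G"
    using c(1) cA notin_B by (auto simp: par_rel_G_notB in_edges_def)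
  ultimately show "(x, y) \<in> (par_rel G)\<^sup>*" using reach_U[OF c(3)] by auto
qed

lemma reach_G_A:
  "x \<in> insertion A v B \<Longrightarrow> y \<in> A - {v} \<Longrightarrow>
    (x, y) \<in> (par_rel G)\<^sup>* \<longleftrightarrow> (if x \<in> B then v else x, y) \<in> (par_rel T)\<^sup>*"
  using reach_G_aux[of x y] reach_T[of _ y x] notin_B[of y] by auto

lemma in_edges_above:
  assumes "x \<in> A - {v}" "(x, v) \<in> (par_rel T)\<^sup>*"
  shows "\<exists>c\<in>in_edges T v. (x, c) \<in> (par_rel T)\<^sup>*"
  using assms by (auto simp: in_edges_def elim: rtranclE)

lemma graft_in_ttrees: "G \<in> ttrees (insertion A v B)"
proof -
  have "dom (par G) = insertion A v B - {root G}"
  proof (intro set_eqI)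
    fix x
    have T': "x \<in> dom (par T) \<longleftrightarrow> x \<in> A - {root T}" for x using T by (simp add: ttrees_def)
    show "x \<in> dom (par G) \<longleftrightarrow> x \<in> insertion A v B - {root G}"
    proof (cases "x \<in> B")
      case True
      then show ?thesis
      proof (cases "x = root U")
        case True
        then have "x \<in> dom (par G) \<longleftrightarrow> v \<in> dom (par T)"
          by (simp add: par_root_U domIff)
        then show ?thesis using True T' v \<open>x \<in> B\<close> root_in[OF T] notin_B[of "root T"]
          by (auto simp: root_G)
      next
        case False
        then obtain p w where "par U x = Some (p, w)" using True by (blast elim: par_Some_ex[OF U])
        then have "x \<in> dom (par G)" by (simp add: par_U domIff)
        then show ?thesis using True False root_in[OF T] notin_B[of "root T"]
          by (auto simp: root_G)
      qed
    next
      case False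
      then show ?thesis
        using T'[of x] root_in[OF U]
        by (cases "x = v") (auto simp: par_v par_T domIff root_G simp del: not_None_eq)
    qed
  qed
  moreover have "(x, root G) \<in> (par_rel G)\<^sup>*" if x: "x \<in> insertion A v B" for x
  proof (cases "root T = v")
    case True
    show ?thesis
    proof (cases "x \<in> B")
      case False
      \<comment> \<open>The path from \<open>x\<close> to the old root \<open>v\<close> ends with
        some edge \<open>c\<close> entering \<open>v\<close>; in \<open>G\<close> it continues from
        \<open>f c\<close> down to \<open>root U\<close>.\<close>
      then obtain c where c: "c \<in> in_edges T v" "(x, c) \<in> (par_rel T)\<^sup>*"
        using in_edges_above[of x] x root_reachable[OF T, of x] True by auto
      then show ?thesis using False True x f root_reachable[OF U] root_in[OF U]
        by (auto simp: root_G reach_G_AB)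
    qed (use True reach_U root_reachable[OF U] root_G in auto)
  next
    case False
    then show ?thesis using x root_reachable[OF T, of x] root_reachable[OF T, of v] v root_in[OF T]
      by (auto simp: root_G reach_G_A)
  qed
  moreover have "root G \<in> insertion A v B"
    using root_in[OF T] root_in[OF U] by (auto simp: root_G)
  moreover have "par_rel G \<subseteq> insertion A v B \<times> insertion A v B"
    using par_rel_G_in by auto
  ultimately show ?thesis unfolding ttrees_def by blast
qed

lemma verts_G: "verts G = insertion A v B"
  using graft_in_ttrees by (rule verts_ttrees)

lemma in_edges_G_B:
  assumes "b \<in> B"
  shows "in_edges G b = in_edges U b \<union> {x \<in> in_edges T v. f x = b}"
proof (intro set_eqI)
  fix x
  show "x \<in> in_edges G b \<longleftrightarrow> x \<in> in_edges U b \<union> {x \<in> in_edges T v. f x = b}"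
  proof (cases "x \<in> B")
    case True
    have "(v, b) \<notin> par_rel T"
      using assms par_rel_in[OF T, of v b] not_par_rel_v_v notin_B[of b] by auto
    moreover have "(x, v) \<notin> par_rel T"
      using True par_rel_in[OF T, of x v] not_par_rel_v_v notin_B[of x] by auto
    ultimately show ?thesis using True par_rel_G_B by (auto simp: in_edges_def)
  next
    case False
    have "(x, b) \<notin> par_rel U" using False par_rel_in[OF U] by auto
    moreover have "(x, b) \<in> par_rel T \<Longrightarrow> b = v"
      using assms par_rel_in[OF T, of x b] notin_B[of b] by auto
    moreover have "(x, v) \<in> par_rel T \<Longrightarrow> x \<noteq> v" using not_par_rel_v_v by auto
    ultimately show ?thesis using False par_rel_G_notB by (auto simp: in_edges_def)
  qed
qed

text \<open>If \<open>v\<close> is a child of \<open>y\<close>, its edge to \<open>y\<close>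
  survives but has \<open>root U\<close> as upper end, hence a new name.\<close>

lemma in_edges_G_A:
  assumes "y \<in> A - {v}"
  shows "in_edges G y = (\<lambda>x. if x = v then root U else x) ` in_edges T y"
proof (intro set_eqI)
  fix x
  have y: "y \<notin> B" "y \<noteq> v" using assms notin_B by auto
  show "x \<in> in_edges G y \<longleftrightarrow> x \<in> (\<lambda>x. if x = v then root U else x) ` in_edges T y"
  proof (cases "x \<in> B")
    case True
    have "(x, y) \<notin> par_rel U" using y par_rel_in[OF U] by auto
    moreover have "(x, y) \<in> par_rel T \<Longrightarrow> x = v"
      using True par_rel_in[OF T, of x y] notin_B[of x] by auto
    ultimately show ?thesis using True par_rel_G_B[OF True] by (auto simp: in_edges_def image_iff)
  next
    case False
    then have "x \<noteq> root U" using root_in[OF U] by auto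
    moreover have "y \<noteq> f x" if "(x, v) \<in> par_rel T" using f[of x] that y by (auto simp: in_edges_def)
    ultimately show ?thesis using False y par_rel_G_notB[OF False] by (auto simp: in_edges_def image_iff)
  qed
qed

lemma edge_type_G_U: "x \<in> B \<Longrightarrow> x \<noteq> root U \<Longrightarrow> edge_type G x =
    acc (edge_type T) {a \<in> in_edges T v. (f a, x) \<in> (par_rel U)\<^sup>*} (edge_type U x)"
  by (erule (1) par_Some_ex[OF U]) (simp add: edge_type_def par_U)

lemma edge_type_G_T: "x \<in> A - {v} \<Longrightarrow> x \<noteq> root T \<Longrightarrow> edge_type G x = edge_type T x"
  using notin_B by (auto simp: edge_type_def par_T elim!: par_Some_ex[OF T])

lemma edge_type_G_root: "edge_type G (root U) = edge_type T v"
  by (simp add: edge_type_def par_root_U)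

end

section \<open>Associativity of grafting\<close>

lemma ttree_eqI: "root T = root U \<Longrightarrow> (\<And>x. par T x = par U x) \<Longrightarrow> T = U"
  by (cases T; cases U) auto

section \<open>Nested insertion: \<open>V\<close> into \<open>U\<close>, and \<open>U\<close> into
  \<open>T\<close>\<close>

locale nested_grafting =
  fixes A B C :: "'a set" and a b :: 'a and f g h k :: "'a \<Rightarrow> 'a"
    and T U V :: "('a, 'w::ab_semigroup_mult) ttree"
  assumes finite: "finite A" "finite B"
    and T: "T \<in> ttrees A" and U: "U \<in> ttrees B" and V: "V \<in> ttrees C"
    and a: "a \<in> A" and b: "b \<in> B"
    and disj: "disjnt (A - {a}) B" "disjnt (A - {a}) C" "disjnt (B - {b}) C"
    and f: "\<And>x. x \<in> in_edges T a \<Longrightarrow> f x \<in> B"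
    and g: "\<And>x. x \<in> in_edges (graft a f T U) b \<Longrightarrow> g x \<in> C"
    and h: "\<And>x. x \<in> in_edges U b \<Longrightarrow> h x = g x"
    and k: "\<And>x. x \<in> in_edges T a \<Longrightarrow> k x = (if f x = b then g x else f x)"
begin

text \<open>The four grafts of the identity: \<open>G\<close> inserts \<open>U\<close> into
  \<open>T\<close> and \<open>L\<close> then inserts \<open>V\<close>; \<open>H\<close> inserts
  \<open>V\<close> into \<open>U\<close> and \<open>R\<close> inserts the result into
  \<open>T\<close>. The claim is that \<open>L.G\<close> and \<open>R.G\<close> coincide.\<close>

sublocale G: grafting A B a f T U
  using T U a disj f by unfold_locales

lemma g_T: "x \<in> in_edges T a \<Longrightarrow> f x = b \<Longrightarrow> g x \<in> C"
  and g_U: "x \<in> in_edges U b \<Longrightarrow> g x \<in> C"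
  using g by (auto simp: G.in_edges_G_B[OF b])

sublocale L: grafting "insertion A a B" C b g G.G V
  using G.graft_in_ttrees V b disj g by unfold_locales (auto simp: disjnt_def)

sublocale H: grafting B C b h U V
  using U V b disj h g_U by unfold_locales auto

sublocale R: grafting A "insertion B b C" a k T H.G
  using T H.graft_in_ttrees a disj f k g_T
  by unfold_locales (auto simp: disjnt_def)

lemma f_in: "d \<in> in_edges T a \<Longrightarrow> f d \<noteq> b \<Longrightarrow> f d \<in> B - {b} \<and> f d \<notin> C"
  using f disj(3) by (auto simp: disjnt_def)

text \<open>Contracting \<open>C\<close> back to \<open>b\<close> turns \<open>k d\<close> into
  \<open>f d\<close>: if \<open>f d = b\<close> then \<open>k d\<close> lies in \<open>C\<close>,
  and otherwise \<open>k d = f d\<close> lies outside \<open>C\<close>.\<close>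

lemma reach_H_B:
  assumes d: "d \<in> in_edges T a" and x: "x \<in> B - {b}"
  shows "(k d, x) \<in> (par_rel H.G)\<^sup>* \<longleftrightarrow> (f d, x) \<in> (par_rel U)\<^sup>*"
  using d x k[OF d] f_in[OF d] g_T[OF d] by (auto simp: H.reach_G_A)

text \<open>An edge of \<open>T\<close> comes to lie above a vertex of \<open>V\<close> either by
  direct attachment to \<open>V\<close> or through an edge \<open>c\<close> of \<open>U\<close>
  entering \<open>b\<close>. If \<open>f d = b\<close>, the second way is impossible, as
  \<open>b\<close> cannot lie above its own child.\<close>

lemma reach_H_C:
  assumes d: "d \<in> in_edges T a" and x: "x \<in> C"
  shows "(k d, x) \<in> (par_rel H.G)\<^sup>* \<longleftrightarrow>
    f d = b \<and> (g d, x) \<in> (par_rel V)\<^sup>* \<or>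
    (\<exists>c\<in>in_edges U b. (f d, c) \<in> (par_rel U)\<^sup>* \<and> (g c, x) \<in> (par_rel V)\<^sup>*)"
proof (cases "f d = b")
  case True
  have "(b, c) \<notin> (par_rel U)\<^sup>*" if "c \<in> in_edges U b" for c
  proof
    assume "(b, c) \<in> (par_rel U)\<^sup>*"
    with that have "(b, b) \<in> (par_rel U)\<^sup>+" by (auto simp: in_edges_def)
    then show False using acyclic_par_rel[OF U] by (auto simp: acyclic_def)
  qed
  then show ?thesis using True x k[OF d] g_T[OF d] by (auto simp: H.reach_G_BB)
next
  case False
  then show ?thesis using x k[OF d] f_in[OF d False] h by (auto simp: H.reach_G_AB)
qed

text \<open>The edge leaving \<open>root V\<close> is the old edge leaving \<open>b\<close>. All of
  \<open>C\<close> lies above \<open>root V\<close>, so the edges of \<open>T\<close> above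
  \<open>root V\<close> after inserting \<open>V\<close> are exactly those that were above
  \<open>b\<close>. If \<open>b\<close> is the root of \<open>U\<close>, the edge is the one leaving
  \<open>a\<close> in \<open>T\<close>, with its type unchanged on both sides.\<close>

lemma par_eq_root_V: "par L.G (root V) = par R.G (root V)"
proof (cases "b = root U")
  case True
  then have "root H.G = root V" using H.root_G by simp
  then have "par R.G (root V) = par T a" using R.par_root_U by simp
  moreover have "par L.G (root V) = par T a" using True G.par_root_U L.par_root_U by simp
  ultimately show ?thesis by simp
next
  case False
  then obtain p w where p: "par U b = Some (p, w)" using b by (blast elim: par_Some_ex[OF U])
  have "(k d, root V) \<in> (par_rel H.G)\<^sup>* \<longleftrightarrow> (f d, b) \<in> (par_rel U)\<^sup>*" if d: "d \<in> in_edges T a" for d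
  proof -
    have "(f d, b) \<in> (par_rel U)\<^sup>* \<longleftrightarrow> f d = b \<or> (\<exists>c\<in>in_edges U b. (f d, c) \<in> (par_rel U)\<^sup>*)"
      by (auto simp: in_edges_def intro: rtrancl_into_rtrancl elim: rtranclE)
    then show ?thesis
      using g_T[OF d] g_U root_reachable[OF V] by (auto simp: reach_H_C[OF d] root_in[OF V])
  qed
  then have "{d \<in> in_edges T a. (k d, root V) \<in> (par_rel H.G)\<^sup>*}
      = {d \<in> in_edges T a. (f d, b) \<in> (par_rel U)\<^sup>*}" by blast
  moreover have "par H.G (root V) = Some (p, w)" using p by (simp add: H.par_root_U)
  ultimately show ?thesis by (simp add: L.par_root_U G.par_U[OF p] R.par_U)
qed

text \<open>The weight of an edge of \<^term>\<open>V\<close> collects the edges grafted above it: on the left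
  those entering \<^term>\<open>b\<close> in the composed tree, each already multiplied by
  the edges of \<^term>\<open>T\<close> grafted above it; on the right first the edges of \<^term>\<open>U\<close>
  and then all edges of \<^term>\<open>T\<close>.\<close>

lemma par_eq_C:
  assumes x: "x \<in> C" "x \<noteq> root V"
  shows "par L.G x = par R.G x"
proof -
  obtain p w where p: "par V x = Some (p, w)" using x by (blast elim: par_Some_ex[OF V])
  \<comment> \<open>The edges contributing on the left: \<open>?N\<close> consists of those coming
    from \<open>U\<close>, \<open>?M\<close> of those of \<open>T\<close> attached directly to
    \<open>b\<close>; \<open>?D c\<close> collects the edges of \<open>T\<close> whose types
    multiply that of \<open>c\<close> when \<open>U\<close> is inserted.\<close>
  let ?N = "{c \<in> in_edges U b. (g c, x) \<in> (par_rel V)\<^sup>*}"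
  let ?M = "{d \<in> in_edges T a. f d = b \<and> (g d, x) \<in> (par_rel V)\<^sup>*}"
  let ?D = "\<lambda>c. {d \<in> in_edges T a. (f d, c) \<in> (par_rel U)\<^sup>*}"
  have fin: "finite (in_edges T a)" "finite (in_edges U b)"
    using finite_in_edges finite T U by metis+
  have In_G: "{c \<in> in_edges G.G b. (g c, x) \<in> (par_rel V)\<^sup>*} = ?N \<union> ?M"
    by (auto simp: G.in_edges_G_B[OF b])
  have In_U: "{c \<in> in_edges U b. (h c, x) \<in> (par_rel V)\<^sup>*} = ?N"
    using h by (intro Collect_cong conj_cong) simp_all
  have disjNM: "?N \<inter> ?M = {}"
    using in_edges_subset[OF U, of b] in_edges_subset[OF T, of a] disj(1)
    unfolding disjnt_def by blast
  have Nb: "c \<noteq> b \<and> c \<in> B \<and> c \<noteq> root U" if "c \<in> ?N" for c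
    using that in_edges_subset[OF U, of b] par_rel_in[OF U, of c b] by (auto simp: in_edges_def)
  have Mb: "d \<in> A - {a} \<and> d \<noteq> root T" if "d \<in> ?M" for d
    using that in_edges_subset[OF T, of a] par_rel_in[OF T, of d a] by (auto simp: in_edges_def)
  have "acc (edge_type G.G) (?N \<union> ?M) w = acc (edge_type G.G) ?N (acc (edge_type G.G) ?M w)"
    using fin disjNM by (intro acc_Un) auto
  also have "acc (edge_type G.G) ?M w = acc (edge_type T) ?M w"
    using fin Mb by (intro acc_cong) (simp_all add: G.edge_type_G_T)
  also have "acc (edge_type G.G) ?N (acc (edge_type T) ?M w)
      = acc (\<lambda>c. acc (edge_type T) (?D c) (edge_type U c)) ?N (acc (edge_type T) ?M w)"
    using fin Nb by (intro acc_cong) (simp_all add: G.edge_type_G_U)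
  \<comment> \<open>The sets \<open>?D c\<close> are disjoint for distinct children \<open>c\<close>
    of \<open>b\<close>, so the nested products flatten to the edges of \<open>T\<close> and those
    of \<open>U\<close> separately.\<close>
  also have "\<dots> = acc (edge_type T) (\<Union>c\<in>?N. ?D c) (acc (edge_type U) ?N (acc (edge_type T) ?M w))"
  proof (rule acc_UNION)
    show "?D c \<inter> ?D c' = {}" if "c \<in> ?N" "c' \<in> ?N" "c \<noteq> c'" for c c'
      using siblings_disjoint[OF U, of c b c'] that by blast
  qed (use fin in auto)
  also have "acc (edge_type U) ?N (acc (edge_type T) ?M w) = acc (edge_type T) ?M (acc (edge_type U) ?N w)"
    using fin by (intro acc_commute) auto
  also have "acc (edge_type T) (\<Union>c\<in>?N. ?D c) (acc (edge_type T) ?M (acc (edge_type U) ?N w))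
      = acc (edge_type T) ((\<Union>c\<in>?N. ?D c) \<union> ?M) (acc (edge_type U) ?N w)"
  proof (rule acc_Un[symmetric])
    show "(\<Union>c\<in>?N. ?D c) \<inter> ?M = {}"
    proof (rule ccontr)
      assume "(\<Union>c\<in>?N. ?D c) \<inter> ?M \<noteq> {}"
      then obtain c where "c \<in> in_edges U b" "(b, c) \<in> (par_rel U)\<^sup>*" by auto
      then have "(b, b) \<in> (par_rel U)\<^sup>+" by (auto simp: in_edges_def)
      then show False using acyclic_par_rel[OF U] by (auto simp: acyclic_def)
    qed
  qed (use fin in auto)
  also have "(\<Union>c\<in>?N. ?D c) \<union> ?M = {d \<in> in_edges T a. (k d, x) \<in> (par_rel H.G)\<^sup>*}"
  proof (intro set_eqI)
    fix d
    show "d \<in> (\<Union>c\<in>?N. ?D c) \<union> ?M \<longleftrightarrow> d \<in> {d \<in> in_edges T a. (k d, x) \<in> (par_rel H.G)\<^sup>*}"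
      using reach_H_C[of d x] x(1) by (cases "d \<in> in_edges T a") auto
  qed
  finally show ?thesis
    by (simp add: L.par_U[OF p] In_G In_U R.par_U[OF H.par_U[OF p]])
qed

lemma par_eq_B:
  assumes x: "x \<in> B - {b}"
  shows "par L.G x = par R.G x"
proof -
  have xC: "x \<notin> C" "x \<noteq> b" using x disj(3) by (auto simp: disjnt_def)
  show ?thesis
  proof (cases "x = root U")
    case True
    then have "root H.G = x" using xC by (simp add: H.root_G)
    then have "par R.G x = par T a" using R.par_root_U by simp
    moreover have "par L.G x = par T a"
    proof (cases "par T a")
      case (Some q)
      then obtain p w where "par T a = Some (p, w)" by force
      \<comment> \<open>As the parent of \<open>a\<close>, the vertex \<open>p\<close> lies in
        \<open>A\<close> and differs from \<open>a\<close>, hence lies outside \<open>B\<close>. So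
        inserting \<open>V\<close> at \<open>b\<close> does not redirect this edge.\<close>
      moreover from this have "p \<noteq> b"
        using b par_rel_in[OF T par_relI] G.not_par_rel_v_v G.notin_B by (metis par_relI)
      ultimately show ?thesis
        using True xC by (simp add: L.par_T G.par_root_U)
    qed (use True xC in \<open>simp add: L.par_T G.par_root_U\<close>)
    ultimately show ?thesis by simp
  next
    case False
    then obtain p w where p: "par U x = Some (p, w)" using x by (blast elim: par_Some_ex[OF U])
    have "{d \<in> in_edges T a. (k d, x) \<in> (par_rel H.G)\<^sup>*}
      = {d \<in> in_edges T a. (f d, x) \<in> (par_rel U)\<^sup>*}" using reach_H_B x by blast
    moreover have "par H.G x = Some (if p = b then h x else p, w)"
      using p xC by (simp add: H.par_T)
    moreover have "p = b \<Longrightarrow> h x = g x" using h p by (auto simp: in_edges_def par_rel_def)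
    ultimately show ?thesis using xC by (simp add: L.par_T G.par_U[OF p] R.par_U)
  qed
qed

lemma par_eq_A:
  assumes x: "x \<notin> B - {b}" "x \<notin> C"
  shows "par L.G x = par R.G x"
proof (cases "x = b")
  case True
  \<comment> \<open>Here \<open>b\<close> is no vertex of the result. If \<open>b = a\<close>, the
    second insertion has removed it from \<open>T\<close>; otherwise disjointness keeps it out of
    \<open>A\<close>.\<close>
  have "par R.G b = None"
  proof (cases "b = a")
    case False
    then have "b \<notin> A" using b G.notin_B by blast
    then show ?thesis using False True x par_outside[OF T] by (simp add: R.par_T)
  qed (use True x R.par_v in auto)
  then show ?thesis using True x L.par_v by simp
next
  case False
  then have "x \<notin> B" using x by simp
  show ?thesis
  proof (cases "x = a")
    case True
    then show ?thesis using False x \<open>x \<notin> B\<close> G.par_v R.par_v L.par_T by simp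
  next
    case xa: False
    show ?thesis
    proof (cases "par T x")
      case (Some q)
      then obtain p w where p: "par T x = Some (p, w)" by force
      have "p \<noteq> a \<Longrightarrow> p \<noteq> b"
        using b par_rel_in[OF T par_relI[OF p]] G.notin_B by auto
      moreover have "p = a \<Longrightarrow> k x = (if f x = b then g x else f x)"
        using p k by (auto simp: in_edges_def par_rel_def)
      ultimately show ?thesis
        using p False xa x \<open>x \<notin> B\<close> by (simp add: L.par_T G.par_T R.par_T)
    qed (use False xa x \<open>x \<notin> B\<close> in \<open>simp add: L.par_T G.par_T R.par_T\<close>)
  qed
qed

lemma graft_nested: "graft b g (graft a f T U) V = graft a k T (graft b h U V)"
proof (rule ttree_eqI)
  have "root T \<noteq> a \<Longrightarrow> root T \<noteq> b" using b root_in[OF T] G.notin_B by auto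
  then show "root L.G = root R.G" by (auto simp: L.root_G G.root_G R.root_G H.root_G)
  show "par L.G x = par R.G x" for x
    using par_eq_root_V par_eq_C par_eq_B par_eq_A by blast
qed

end

section \<open>Parallel insertion: \<open>U\<close> and \<open>V\<close> at two vertices of
  \<open>T\<close>\<close>

locale parallel_grafting =
  fixes A B C :: "'a set" and a a' :: 'a and f g f' g' :: "'a \<Rightarrow> 'a"
    and T U V :: "('a, 'w::ab_semigroup_mult) ttree"
  assumes finite: "finite A"
    and T: "T \<in> ttrees A" and U: "U \<in> ttrees B" and V: "V \<in> ttrees C"
    and a: "a \<in> A" and a': "a' \<in> A" and neq: "a \<noteq> a'"
    and disj: "disjnt (A - {a}) B" "disjnt (A - {a'}) C" "disjnt B C"
    and f: "\<And>x. x \<in> in_edges T a \<Longrightarrow> f x \<in> B"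
    and g: "\<And>x. x \<in> in_edges T a' \<Longrightarrow> g x \<in> C"
    and f': "\<And>x. x \<in> in_edges T a \<Longrightarrow> f' (if x = a' then root V else x) = f x"
    and g': "\<And>x. x \<in> in_edges T a' \<Longrightarrow> g' (if x = a then root U else x) = g x"
begin

sublocale G: grafting A B a f T U
  using T U a disj f by unfold_locales

sublocale H: grafting A C a' g T V
  using T V a' disj g by unfold_locales

text \<open>The map \<open>g'\<close> is defined on edges entering \<open>a'\<close> after
  \<open>U\<close> has been inserted at \<open>a\<close>. If \<open>a\<close> is a child of
  \<open>a'\<close>, its edge is now called \<open>root U\<close>, so the value \<open>g a\<close>
  is found at \<open>g' (root U)\<close>; all other edges keep their names.\<close>

sublocale L: grafting "insertion A a B" C a' g' G.G V
proof unfold_locales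
  show "g' x \<in> C" if x: "x \<in> in_edges G.G a'" for x
  proof -
    obtain y where "y \<in> in_edges T a'" "x = (if y = a then root U else y)"
      using x neq a' by (auto simp: G.in_edges_G_A)
    then show ?thesis using g g' by metis
  qed
qed (use G.graft_in_ttrees V a' neq disj in \<open>auto simp: disjnt_def\<close>)

sublocale R: grafting "insertion A a' C" B a f' H.G U
proof unfold_locales
  show "f' x \<in> B" if x: "x \<in> in_edges H.G a" for x
  proof -
    obtain y where "y \<in> in_edges T a" "x = (if y = a' then root V else y)"
      using x neq a by (auto simp: H.in_edges_G_A)
    then show ?thesis using f f' by metis
  qed
qed (use H.graft_in_ttrees U a neq disj in \<open>auto simp: disjnt_def\<close>)

lemma notin: "a' \<notin> B" "a \<notin> C" "x \<in> B \<Longrightarrow> x \<notin> C"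
  using a a' neq disj by (auto simp: disjnt_def)

text \<open>If \<open>x\<close> is the root of \<open>U\<close>, its edge is the one leaving
  \<open>a\<close>, possibly redirected into \<open>V\<close> in case the parent of \<open>a\<close>
  is \<open>a'\<close>. For any other \<open>x\<close>, inserting \<open>V\<close> first only
  renames the edges entering \<open>a\<close>; their types are unchanged, so the product of factors
  is the same.\<close>

lemma par_eq_B:
  assumes x: "x \<in> B"
  shows "par L.G x = par R.G x"
proof -
  have xa': "x \<noteq> a'" using x notin(1) by blast
  show ?thesis
  proof (cases "x = root U")
    case True
    have "par R.G x = map_option (\<lambda>(p, w). (if p = a' then g a else p, w)) (par T a)"
      using True neq notin H.par_T[of a] by (simp add: R.par_root_U)
    also have "\<dots> = map_option (\<lambda>(p, w). (if p = a' then g' x else p, w)) (par T a)"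
      using g'[of a] True by (cases "par T a") (auto simp: in_edges_def par_rel_def)
    also have "\<dots> = par L.G x"
      using xa' notin(3)[OF x] unfolding True by (simp add: L.par_T G.par_root_U)
    finally show ?thesis by simp
  next
    case False
    then obtain p w where p: "par U x = Some (p, w)" using x by (blast elim: par_Some_ex[OF U])
    let ?m = "\<lambda>x. if x = a' then root V else x"
    let ?D = "{d \<in> in_edges T a. (f d, x) \<in> (par_rel U)\<^sup>*}"
    have sub: "in_edges T a \<subseteq> A - {root T}"
      using par_rel_in[OF T] by (auto simp: in_edges_def)
    have "in_edges H.G a = ?m ` in_edges T a" using a neq by (simp add: H.in_edges_G_A)
    then have "{e \<in> in_edges H.G a. (f' e, x) \<in> (par_rel U)\<^sup>*}
        = ?m ` {d \<in> in_edges T a. (f' (?m d), x) \<in> (par_rel U)\<^sup>*}" by auto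
    also have "{d \<in> in_edges T a. (f' (?m d), x) \<in> (par_rel U)\<^sup>*} = ?D"
      using f' by (intro Collect_cong conj_cong) simp_all
    finally have "{e \<in> in_edges H.G a. (f' e, x) \<in> (par_rel U)\<^sup>*} = ?m ` ?D" .
    then have "acc (edge_type H.G) {e \<in> in_edges H.G a. (f' e, x) \<in> (par_rel U)\<^sup>*} w
        = acc (edge_type H.G) (?m ` ?D) w" by simp
    also have "acc (edge_type H.G) (?m ` ?D) w = acc (edge_type H.G \<circ> ?m) ?D w"
    proof (rule acc_image)
      \<comment> \<open>The new name \<open>root V\<close> lies in \<open>C\<close>, which meets
        \<open>A\<close> at most in \<open>a'\<close>, so it collides with no other edge.\<close>
      show "inj_on ?m ?D"
        using sub root_in[OF V] H.notin_B by (auto simp: inj_on_def)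
    qed (use finite_in_edges[OF finite T] in auto)
    also have "\<dots> = acc (edge_type T) ?D w"
    proof (rule acc_cong)
      fix d assume "d \<in> ?D"
      then have "d \<in> A" "d \<noteq> root T" using sub by auto
      then show "(edge_type H.G \<circ> ?m) d = edge_type T d"
        by (simp add: H.edge_type_G_root H.edge_type_G_T)
    qed (use finite_in_edges[OF finite T] in simp)
    finally have "par R.G x = Some (p, acc (edge_type T) ?D w)" by (simp add: R.par_U[OF p])
    moreover have "p \<noteq> a'" using notin par_rel_in[OF U par_relI[OF p]] by auto
    ultimately show ?thesis
      using xa' notin(3)[OF x] by (simp add: L.par_T G.par_U[OF p])
  qed
qed

text \<open>The situation is symmetric in the two insertions, so the comparison on \<open>C\<close>
  follows from that on \<open>B\<close>.\<close>

lemma swapped: "parallel_grafting A C B a' a g f g' f' T V U"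
  using finite T U V a a' neq disj(1,2) disjnt_sym[OF disj(3)] f g f' g' by unfold_locales auto

lemma par_eq_A:
  assumes x: "x \<notin> B" "x \<notin> C"
  shows "par L.G x = par R.G x"
proof -
  consider "x = a" | "x = a'" | "x \<noteq> a" "x \<noteq> a'" by blast
  then show ?thesis
  proof cases
    case 1
    then show ?thesis using x neq by (simp add: L.par_T G.par_v R.par_v)
  next
    case 2
    then show ?thesis using x neq by (simp add: R.par_T H.par_v L.par_v)
  next
    case 3
    show ?thesis
    proof (cases "par T x")
      case (Some q)
      then obtain p w where p: "par T x = Some (p, w)" by force
      then have "p = a \<Longrightarrow> f' x = f x \<and> f x \<in> B" "p = a' \<Longrightarrow> g' x = g x \<and> g x \<in> C"
        using f g f'[of x] g'[of x] 3 by (auto simp: in_edges_def par_rel_def)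
      then show ?thesis using p 3 x notin neq by (auto simp: L.par_T R.par_T G.par_T H.par_T)
    qed (use 3 x in \<open>simp add: L.par_T R.par_T G.par_T H.par_T\<close>)
  qed
qed

lemma graft_parallel: "graft a' g' (graft a f T U) V = graft a f' (graft a' g T V) U"
proof (rule ttree_eqI)
  interpret sw: parallel_grafting A C B a' a g f g' f' T V U by (rule swapped)
  show "root L.G = root R.G"
    using notin neq root_in[OF U] root_in[OF V]
    by (auto simp: L.root_G G.root_G R.root_G H.root_G)
  fix x
  consider "x \<in> B" | "x \<in> C" | "x \<notin> B" "x \<notin> C" by blast
  then show "par L.G x = par R.G x"
    by cases (rule par_eq_B, assumption, rule sw.par_eq_B[symmetric], assumption, rule par_eq_A)
qed

end

section \<open>Relabelling and units\<close>

text \<open>The hypotheses say that \<open>s\<close> is an isomorphism from \<open>T'\<close> to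
  \<open>T\<close>. Exhibiting one suffices to identify a pullback and avoids computing with
  \<open>inv_into\<close>; functoriality, equivariance of grafting and the right unit law are all
  obtained this way.\<close>

lemma relabel_unique:
  assumes s: "bij_betw s A A'" and T: "T \<in> ttrees A'" and T': "T' \<in> ttrees A"
    and root: "root T = s (root T')"
    and par: "\<And>x. x \<in> A \<Longrightarrow> par T (s x) = map_option (\<lambda>(p, w). (s p, w)) (par T' x)"
  shows "relabel A s T = T'"
proof (rule ttree_eqI)
  have inv: "inv_into A s (s x) = x" if "x \<in> A" for x
    using that s by (simp add: bij_betw_inv_into_left)
  show "root (relabel A s T) = root T'"
    using root_in[OF T'] by (simp add: relabel_def root inv)
  show "par (relabel A s T) x = par T' x" for x
  proof (cases "x \<in> A")
    case True
    then show ?thesis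
    proof (cases "par T' x")
      case (Some q)
      then obtain p w where p: "par T' x = Some (p, w)" by force
      then have "p \<in> A" using par_rel_in[OF T' par_relI] by blast
      then show ?thesis using True p by (simp add: relabel_def par inv)
    qed (simp add: relabel_def par)
  qed (simp add: relabel_def par_outside[OF T'])
qed

locale relabelling =
  fixes A A' :: "'a set" and s :: "'a \<Rightarrow> 'a" and T :: "('a, 'w) ttree"
  assumes s: "bij_betw s A A'" and T: "T \<in> ttrees A'"
begin

abbreviation "R \<equiv> relabel A s T"

lemma s_in: "x \<in> A \<Longrightarrow> s x \<in> A'"
  using s by (auto simp: bij_betw_def)

lemma s_eq: "x \<in> A \<Longrightarrow> y \<in> A \<Longrightarrow> s x = s y \<longleftrightarrow> x = y"
  using s by (auto simp: bij_betw_def inj_on_def)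

lemma inv_in: "y \<in> A' \<Longrightarrow> inv_into A s y \<in> A"
  using s by (metis bij_betw_def inv_into_into)

lemma s_inv: "y \<in> A' \<Longrightarrow> s (inv_into A s y) = y"
  using s by (simp add: bij_betw_inv_into_right)

lemma inv_s: "x \<in> A \<Longrightarrow> inv_into A s (s x) = x"
  using s by (simp add: bij_betw_inv_into_left)

lemma root_R: "root R = inv_into A s (root T)"
  by (simp add: relabel_def)

lemma s_root_R: "s (root R) = root T"
  using root_in[OF T] by (simp add: root_R s_inv)

lemma root_R_in: "root R \<in> A"
  using root_in[OF T] by (simp add: root_R inv_in)

lemma par_s:
  assumes "x \<in> A"
  shows "par T (s x) = map_option (\<lambda>(p, w). (s p, w)) (par R x)"
proof (cases "par T (s x)")
  case (Some q)
  then obtain p w where p: "par T (s x) = Some (p, w)" by force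
  then have "p \<in> A'" using par_rel_in[OF T par_relI] by blast
  then show ?thesis using assms p by (simp add: relabel_def s_inv)
qed (use assms in \<open>simp add: relabel_def\<close>)

lemma par_R_Some:
  assumes "par R x = Some (p, w)"
  shows "x \<in> A" "p \<in> A" "par T (s x) = Some (s p, w)"
proof -
  show x: "x \<in> A" using assms by (auto simp: relabel_def split: if_splits)
  then obtain q where q: "par T (s x) = Some (q, w)" "p = inv_into A s q"
    using assms by (auto simp: relabel_def)
  then show "p \<in> A" using par_rel_in[OF T par_relI] inv_in by blast
  show "par T (s x) = Some (s p, w)" using x assms by (simp add: par_s)
qed

lemma par_rel_R: "(x, y) \<in> par_rel R \<longleftrightarrow> x \<in> A \<and> y \<in> A \<and> (s x, s y) \<in> par_rel T"
proof
  assume "(x, y) \<in> par_rel R"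
  then show "x \<in> A \<and> y \<in> A \<and> (s x, s y) \<in> par_rel T"
    using par_R_Some by (auto simp: par_rel_def)
next
  assume "x \<in> A \<and> y \<in> A \<and> (s x, s y) \<in> par_rel T"
  then show "(x, y) \<in> par_rel R"
    by (auto simp: par_rel_def relabel_def inv_s)
qed

lemma reach_R:
  assumes "x \<in> A" "y \<in> A"
  shows "(x, y) \<in> (par_rel R)\<^sup>* \<longleftrightarrow> (s x, s y) \<in> (par_rel T)\<^sup>*"
proof
  assume "(x, y) \<in> (par_rel R)\<^sup>*"
  then show "(s x, s y) \<in> (par_rel T)\<^sup>*"
    by induction (auto simp: par_rel_R intro: rtrancl_into_rtrancl)
next
  have "(x, inv_into A s z) \<in> (par_rel R)\<^sup>*" if "(s x, z) \<in> (par_rel T)\<^sup>*" for z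
    using that
  proof induction
    case base
    then show ?case using assms(1) by (simp add: inv_s)
  next
    case (step y z)
    then have "(inv_into A s y, inv_into A s z) \<in> par_rel R"
      using par_rel_in[OF T step.hyps(2)] by (simp add: par_rel_R inv_in s_inv)
    then show ?case using step.IH by simp
  qed
  moreover assume "(s x, s y) \<in> (par_rel T)\<^sup>*"
  ultimately show "(x, y) \<in> (par_rel R)\<^sup>*" using assms(2) by (metis inv_s)
qed

lemma relabel_in_ttrees: "R \<in> ttrees A"
proof -
  have "x \<in> dom (par R) \<longleftrightarrow> x \<in> A - {root R}" for x
  proof (cases "x \<in> A")
    case True
    then have "x \<in> dom (par R) \<longleftrightarrow> s x \<in> dom (par T)" by (simp add: par_s domIff)
    also have "\<dots> \<longleftrightarrow> s x \<noteq> root T" using T s_in[OF True] by (simp add: ttrees_def)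
    also have "\<dots> \<longleftrightarrow> x \<noteq> root R" using True s_eq[OF True root_R_in] s_root_R by simp
    finally show ?thesis using True by simp
  qed (simp add: relabel_def domIff)
  moreover have "(x, root R) \<in> (par_rel R)\<^sup>*" if "x \<in> A" for x
    using that root_reachable[OF T s_in[OF that]] by (simp add: reach_R root_R_in s_root_R)
  ultimately show ?thesis
    unfolding ttrees_def using root_R_in par_rel_R by auto
qed

lemma bij_betw_in_edges: "y \<in> A \<Longrightarrow> bij_betw s (in_edges R y) (in_edges T (s y))"
proof (rule bij_betw_imageI)
  assume y: "y \<in> A"
  show "inj_on s (in_edges R y)" by (auto simp: in_edges_def par_rel_R s_eq inj_on_def)
  show "s ` in_edges R y = in_edges T (s y)"
  proof
    show "in_edges T (s y) \<subseteq> s ` in_edges R y"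
    proof
      fix z assume z: "z \<in> in_edges T (s y)"
      then have "z \<in> A'" using par_rel_in[OF T] by (auto simp: in_edges_def)
      then have "inv_into A s z \<in> in_edges R y" "s (inv_into A s z) = z"
        using z y by (simp_all add: in_edges_def par_rel_R inv_in s_inv)
      then show "z \<in> s ` in_edges R y" by (metis imageI)
    qed
  qed (auto simp: in_edges_def par_rel_R)
qed

lemma edge_type_R: "x \<in> A \<Longrightarrow> x \<noteq> root R \<Longrightarrow> edge_type R x = edge_type T (s x)"
  by (erule (1) par_Some_ex[OF relabel_in_ttrees]) (simp add: edge_type_def par_R_Some(3))

end

lemma relabel_id: "T \<in> ttrees A \<Longrightarrow> relabel A id T = T"
  by (rule relabel_unique[of _ _ A]) (auto simp: option.map_id0 case_prod_eta)

lemma relabel_cong: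
  assumes "\<And>x. x \<in> A \<Longrightarrow> s x = s' x"
  shows "relabel A s T = relabel A s' T"
proof -
  have "inv_into A s = inv_into A s'"
    unfolding inv_into_def using assms by (auto simp: fun_eq_iff intro!: arg_cong[where f = Eps])
  then show ?thesis using assms by (auto simp: relabel_def fun_eq_iff)
qed

lemma relabel_comp:
  assumes s: "bij_betw s A B" and t: "bij_betw t B C" and T: "T \<in> ttrees C"
  shows "relabel A (t \<circ> s) T = relabel A s (relabel B t T)"
proof -
  interpret t: relabelling B C t T using t T by unfold_locales
  interpret s: relabelling A B s "relabel B t T" using s t.relabel_in_ttrees by unfold_locales
  show ?thesis
  proof (rule relabel_unique)
    show "bij_betw (t \<circ> s) A C" using s t by (rule bij_betw_trans)
    show "par T ((t \<circ> s) x) = map_option (\<lambda>(p, w). ((t \<circ> s) p, w)) (par (relabel A s (relabel B t T)) x)"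
      if "x \<in> A" for x
      using that by (simp add: t.par_s s.s_in s.par_s option.map_comp comp_def case_prod_beta')
  qed (use T s.relabel_in_ttrees s.s_root_R t.s_root_R in auto)
qed

text \<open>The map \<open>f'\<close> is \<open>f\<close> transported along \<open>s\<close> on
  edges and along \<open>t\<close> on vertices. Then \<open>s\<close> carries the edges grafted
  above \<open>x\<close> bijectively to those grafted above \<open>t x\<close> and preserves their
  types, so the products agree.\<close>

lemma relabel_graft:
  assumes fin: "finite A" and a: "a \<in> A" and disj: "disjnt (A - {a}) B"
    and s: "bij_betw s A A'" and t: "bij_betw t B B'" and disj': "disjnt (A' - {s a}) B'"
    and T: "T \<in> ttrees A'" and U: "U \<in> ttrees B'"
    and f: "\<And>x. x \<in> in_edges (relabel A s T) a \<Longrightarrow> f x \<in> B"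
    and f': "\<And>x. x \<in> in_edges (relabel A s T) a \<Longrightarrow> f' (s x) = t (f x)"
  shows "relabel (insertion A a B) (\<lambda>z. if z \<in> B then t z else s z) (graft (s a) f' T U)
    = graft a f (relabel A s T) (relabel B t U)"
proof -
  interpret s: relabelling A A' s T using s T by unfold_locales
  interpret t: relabelling B B' t U using t U by unfold_locales
  interpret R: grafting A B a f s.R t.R
    using s.relabel_in_ttrees t.relabel_in_ttrees a disj f by unfold_locales
  have f'_in: "f' y \<in> B'" if "y \<in> in_edges T (s a)" for y
  proof -
    have "y \<in> s ` in_edges s.R a"
      using that bij_betw_imp_surj_on[OF s.bij_betw_in_edges[OF a]] by simp
    then show ?thesis using f f' t.s_in by auto
  qed
  interpret G: grafting A' B' "s a" f' T U
    using T U a disj' s.s_in f'_in by unfold_locales auto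
  let ?\<sigma> = "\<lambda>z. if z \<in> B then t z else s z"
  have \<sigma>_A: "?\<sigma> x = s x" if "x \<in> A" "x \<noteq> a" for x
    using that R.notin_B by simp
  show ?thesis
  proof (rule relabel_unique)
    have "bij_betw s (A - {a}) (A' - {s a})"
      using s a by (intro bij_betw_DiffI) (auto simp: bij_betw_def)
    then have "bij_betw ?\<sigma> (A - {a}) (A' - {s a})"
      by (rule bij_betw_cong[THEN iffD1, rotated]) (simp add: \<sigma>_A)
    moreover have "bij_betw ?\<sigma> B B'"
      using t by (rule bij_betw_cong[THEN iffD1, rotated]) simp
    ultimately show "bij_betw ?\<sigma> (insertion A a B) (insertion A' (s a) B')"
      using disj' by (intro bij_betw_combine) (auto simp: disjnt_def)
    show "G.G \<in> ttrees (insertion A' (s a) B')" by (rule G.graft_in_ttrees)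
    show "R.G \<in> ttrees (insertion A a B)" by (rule R.graft_in_ttrees)
    have "root T = s a \<longleftrightarrow> root s.R = a"
      using s.s_root_R s.s_eq[OF s.root_R_in a] by simp
    then show "root G.G = ?\<sigma> (root R.G)"
      using s.s_root_R t.s_root_R t.root_R_in s.root_R_in \<sigma>_A[of "root s.R"]
      by (auto simp: G.root_G R.root_G)
    fix x assume x: "x \<in> insertion A a B"
    consider "x = root t.R" | "x \<in> B" "x \<noteq> root t.R" | "x \<in> A" "x \<noteq> a" "x \<notin> B"
      using x by blast
    then show "par G.G (?\<sigma> x) = map_option (\<lambda>(p, w). (?\<sigma> p, w)) (par R.G x)"
    proof cases
      case 1
      have "par G.G (?\<sigma> x) = par T (s a)"
        using 1 t.root_R_in t.s_root_R G.par_root_U by simp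
      also have "\<dots> = map_option (\<lambda>(p, w). (s p, w)) (par s.R a)" using a by (rule s.par_s)
      \<comment> \<open>The combined bijection agrees with \<open>s\<close> on the parent of
        \<open>a\<close>, which lies in \<open>A\<close> and differs from \<open>a\<close>.\<close>
      also have "\<dots> = map_option (\<lambda>(p, w). (?\<sigma> p, w)) (par s.R a)"
      proof (cases "par s.R a")
        case (Some q)
        then obtain p w where p: "par s.R a = Some (p, w)" by force
        then have "p \<in> A" "p \<noteq> a"
          using s.par_R_Some R.not_par_rel_v_v by (auto simp: par_rel_def)
        then show ?thesis using p \<sigma>_A[of p] by simp
      qed simp
      finally show ?thesis using 1 R.par_root_U by simp
    next
      case 2
      then obtain p w where p: "par t.R x = Some (p, w)"
        by (blast elim: par_Some_ex[OF t.relabel_in_ttrees])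
      let ?D = "{d \<in> in_edges s.R a. (f d, x) \<in> (par_rel t.R)\<^sup>*}"
      note sub = par_rel_in[OF s.relabel_in_ttrees, of _ a]
      have finD: "finite ?D" using finite_in_edges[OF fin s.relabel_in_ttrees] by simp
      have "{d \<in> in_edges T (s a). (f' d, t x) \<in> (par_rel U)\<^sup>*}
          = s ` {d \<in> in_edges s.R a. (f' (s d), t x) \<in> (par_rel U)\<^sup>*}"
        using s.bij_betw_in_edges[OF a] by (auto simp: bij_betw_def)
      also have "{d \<in> in_edges s.R a. (f' (s d), t x) \<in> (par_rel U)\<^sup>*} = ?D"
        using f f' 2(1) by (intro Collect_cong conj_cong) (simp_all add: t.reach_R)
      finally have "acc (edge_type T) {d \<in> in_edges T (s a). (f' d, t x) \<in> (par_rel U)\<^sup>*} w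
          = acc (edge_type T) (s ` ?D) w" by simp
      also have "\<dots> = acc (edge_type T \<circ> s) ?D w"
        using finD s.bij_betw_in_edges[OF a] by (intro acc_image) (auto simp: bij_betw_def inj_on_def)
      also have "\<dots> = acc (edge_type s.R) ?D w"
        using finD sub by (intro acc_cong) (auto simp: s.edge_type_R in_edges_def)
      finally show ?thesis
        using 2 p t.par_R_Some[OF p] G.par_U[OF t.par_R_Some(3)[OF p]] R.par_U[OF p] by simp
    next
      case 3
      have sx: "s x \<noteq> s a" "s x \<notin> B'" using 3 a s.s_eq s.s_in G.notin_B[of "s x"] by auto
      show ?thesis
      proof (cases "par s.R x")
        case None
        then show ?thesis using 3 sx by (simp add: G.par_T R.par_T s.par_s)
      next
        case (Some q)
        then obtain p w where p: "par s.R x = Some (p, w)" by force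
        show ?thesis
        proof (cases "p = a")
          case True
          then have "x \<in> in_edges s.R a" using p by (auto simp: in_edges_def par_rel_def)
          then show ?thesis using True p 3 sx f f' by (simp add: G.par_T R.par_T s.par_s)
        next
          case False
          then have "s p \<noteq> s a" "?\<sigma> p = s p" using s.par_R_Some[OF p] s.s_eq a \<sigma>_A[of p] by auto
          then show ?thesis using False p 3 sx by (simp add: G.par_T R.par_T s.par_s)
        qed
      qed
    qed
  qed
qed

section \<open>The one-vertex tree as unit\<close>

lemma single_vertex_in_ttrees: "TTree v (\<lambda>_. None) \<in> ttrees {v}"
  by (simp add: ttrees_def par_rel_def)

lemma par_rel_single_vertex: "par_rel (TTree v (\<lambda>_. None)) = {}"
  by (simp add: par_rel_def)

text \<open>The vertex \<open>v\<close> has no incoming edge, so every product of factors is empty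
  and no type of \<open>U\<close> changes.\<close>

lemma graft_single_vertex_left:
  assumes "U \<in> ttrees B"
  shows "graft v f (TTree v (\<lambda>_. None)) U = U"
  using assms by (intro ttree_eqI)
    (auto simp: graft_def in_edges_def par_rel_single_vertex verts_ttrees par_outside option.map_id0)

text \<open>The inserted tree has no edge whose type could change, and all edges entering
  \<open>b\<close> must be attached to \<open>v\<close>. Only the name of one vertex
  changes.\<close>

lemma graft_single_vertex_right:
  assumes T: "T \<in> ttrees B" and b: "b \<in> B" and disj: "disjnt (B - {b}) {v}"
    and f: "\<And>x. x \<in> in_edges T b \<Longrightarrow> f x = v"
  shows "graft b f T (TTree v (\<lambda>_. None))
    = relabel (insertion B b {v}) (\<lambda>z. if z = v then b else z) T"
proof -
  interpret grafting B "{v}" b f T "TTree v (\<lambda>_. None)"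
    using T b disj f single_vertex_in_ttrees by unfold_locales auto
  let ?\<sigma> = "\<lambda>z. if z = v then b else z"
  have v: "x \<noteq> v" if "x \<in> B" "x \<noteq> b" for x using that notin_B by simp
  show ?thesis
  proof (rule relabel_unique[symmetric])
    show "bij_betw ?\<sigma> (insertion B b {v}) B"
    proof (rule bij_betwI[where g = "\<lambda>z. if z = b then v else z"])
    qed (use b v in auto)
    show "root T = ?\<sigma> (root G)" using v[of "root T"] root_in[OF T] by (simp add: root_G)
    show "G \<in> ttrees (insertion B b {v})" by (rule graft_in_ttrees)
    fix x assume x: "x \<in> insertion B b {v}"
    have \<sigma>_parent: "p \<in> B \<Longrightarrow> p \<noteq> b \<Longrightarrow> ?\<sigma> p = p" for p using v by auto
    show "par T (?\<sigma> x) = map_option (\<lambda>(p, w). (?\<sigma> p, w)) (par G x)"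
    proof (cases "x = v")
      case True
      have G: "par G v = par T b" using par_root_U by simp
      show ?thesis
      proof (cases "par T b")
        case (Some q)
        then obtain p w where p: "par T b = Some (p, w)" by force
        then have "(b, p) \<in> par_rel T" by (rule par_relI)
        then have "p \<in> B" "p \<noteq> b" using not_par_rel_v_v par_rel_in[OF T] by blast+
        then have "?\<sigma> p = p" by (rule \<sigma>_parent)
        then show ?thesis using True p by (simp add: G)
      qed (use True in \<open>simp add: G\<close>)
    next
      case False
      then have "x \<noteq> b" "x \<notin> {v}" using x by auto
      then have G: "par G x = map_option (\<lambda>(p, w). (if p = b then f x else p, w)) (par T x)"
        by (intro par_T)
      show ?thesis
      proof (cases "par T x")
        case (Some q)
        then obtain p w where p: "par T x = Some (p, w)" by force
        then have e: "(x, p) \<in> par_rel T" by (rule par_relI)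
        show ?thesis
        proof (cases "p = b")
          case True
          then have "f x = v" using e by (intro assms(4)) (simp add: in_edges_def)
          then show ?thesis using True False p by (simp add: G)
        next
          case p': False
          then have "?\<sigma> p = p" using e par_rel_in[OF T] by (intro \<sigma>_parent) blast+
          then show ?thesis using p' False p by (simp add: G)
        qed
      qed (use False in \<open>simp add: G\<close>)
    qed
  qed (rule T)
qed

section \<open>Linear extension\<close>

lemma lookup_RTF_scale: "Poly_Mapping.lookup (RTF_scale r c) T = r * Poly_Mapping.lookup c T"
  by (simp add: RTF_scale_def Poly_Mapping.map.rep_eq when_def)

lemma RTF_scale_add_right: "RTF_scale r (c + d) = RTF_scale r c + RTF_scale r d"
  by (rule poly_mapping_eqI) (simp add: lookup_RTF_scale lookup_add distrib_left)

lemma RTF_scale_add_left: "RTF_scale (r + s) c = RTF_scale r c + RTF_scale s c"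
  by (rule poly_mapping_eqI) (simp add: lookup_RTF_scale lookup_add distrib_right)

lemma RTF_scale_scale: "RTF_scale r (RTF_scale s c) = RTF_scale (r * s) c"
  by (rule poly_mapping_eqI) (simp add: lookup_RTF_scale mult.assoc)

lemma RTF_scale_one [simp]: "RTF_scale 1 c = c"
  by (rule poly_mapping_eqI) (simp add: lookup_RTF_scale)

lemma RTF_scale_0_left [simp]: "RTF_scale 0 c = 0"
  by (rule poly_mapping_eqI) (simp add: lookup_RTF_scale)

lemma RTF_scale_0_right [simp]: "RTF_scale r 0 = 0"
  by (rule poly_mapping_eqI) (simp add: lookup_RTF_scale)

lemma RTF_scale_sum: "RTF_scale r (\<Sum>i\<in>I. c i) = (\<Sum>i\<in>I. RTF_scale r (c i))"
  by (induction I rule: infinite_finite_induct) (simp_all add: RTF_scale_add_right)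

lemma RTF_scale_single: "RTF_scale r (Poly_Mapping.single T s) = Poly_Mapping.single T (r * s)"
  by (rule poly_mapping_eqI) (simp add: lookup_RTF_scale lookup_single when_def)

text \<open>The linear extension of a map \<open>h\<close> given on a basis. Action and composition
  are rewritten in this form, which reduces the operad laws to identities between basis
  trees.\<close>

definition lin :: "('b \<Rightarrow> (('a, 'w) ttree \<Rightarrow>\<^sub>0 'k)) \<Rightarrow> ('b \<Rightarrow>\<^sub>0 'k) \<Rightarrow>
    (('a, 'w) ttree \<Rightarrow>\<^sub>0 'k::{comm_ring,comm_monoid_mult})" where
  "lin h c = (\<Sum>x\<in>Poly_Mapping.keys c. RTF_scale (Poly_Mapping.lookup c x) (h x))"

text \<open>Supports can shrink under addition and scaling. Summing over a common larger set, where
  the extra coefficients vanish, makes additivity and homogeneity termwise.\<close>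

lemma lin_superset:
  assumes "finite S" "Poly_Mapping.keys c \<subseteq> S"
  shows "lin h c = (\<Sum>x\<in>S. RTF_scale (Poly_Mapping.lookup c x) (h x))"
  unfolding lin_def by (intro sum.mono_neutral_left assms) (auto simp: in_keys_iff)

lemma lin_cong: "(\<And>x. x \<in> Poly_Mapping.keys c \<Longrightarrow> h x = h' x) \<Longrightarrow> lin h c = lin h' c"
  by (simp add: lin_def)

lemma lin_zero [simp]: "lin h 0 = 0"
  by (simp add: lin_def)

lemma lin_add: "lin h (c + d) = lin h c + lin h d"
proof -
  let ?S = "Poly_Mapping.keys c \<union> Poly_Mapping.keys d"
  have "finite ?S" by simp
  then show ?thesis
    using lin_superset[of ?S c h] lin_superset[of ?S d h]
      lin_superset[of ?S "c + d" h] Poly_Mapping.keys_add[of c d]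
    by (simp add: lookup_add RTF_scale_add_left sum.distrib)
qed

lemma lin_sum: "lin h (\<Sum>i\<in>I. c i) = (\<Sum>i\<in>I. lin h (c i))"
  by (induction I rule: infinite_finite_induct) (simp_all add: lin_add)

lemma lin_scale: "lin h (RTF_scale r c) = RTF_scale r (lin h c)"
proof -
  have "Poly_Mapping.keys (RTF_scale r c) \<subseteq> Poly_Mapping.keys c"
    by (auto simp: in_keys_iff lookup_RTF_scale)
  then show ?thesis
    by (simp add: lin_superset[OF finite_keys, of _ c] RTF_scale_sum lookup_RTF_scale RTF_scale_scale)
qed

lemma lin_single: "lin h (Poly_Mapping.single x r) = RTF_scale r (h x)"
  by (simp add: lin_def)

lemma lin_lin: "lin h (lin g c) = lin (\<lambda>x. lin h (g x)) c"
  by (simp add: lin_def[of g] lin_def[of "\<lambda>x. lin h (g x)"] lin_sum lin_scale)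

text \<open>Exchange of the two finite sums of a bilinear extension; the coefficients change order,
  so commutativity of the ground ring enters.\<close>

lemma lin_swap: "lin (\<lambda>x. lin (h x) d) c = lin (\<lambda>y. lin (\<lambda>x. h x y) c) d"
  by (simp add: lin_def RTF_scale_sum RTF_scale_scale mult.commute sum.swap[of _ "Poly_Mapping.keys c"])

lemma lin_add_fun: "lin (\<lambda>x. g x + h x) c = lin g c + lin h c"
  by (simp add: lin_def RTF_scale_add_right sum.distrib)

lemma lin_scale_fun: "lin (\<lambda>x. RTF_scale r (h x)) c = RTF_scale r (lin h c)"
  by (simp add: lin_def RTF_scale_sum RTF_scale_scale mult.commute)

lemma lin_ident: "lin (\<lambda>T. Poly_Mapping.single T 1) c = c"
  by (rule poly_mapping_eqI)
    (simp add: lin_def RTF_scale_single lookup_sum lookup_single when_def in_keys_iff)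

lemma RTF_zero: "0 \<in> RTF A"
  by (simp add: RTF_def)

lemma RTF_add: "c \<in> RTF A \<Longrightarrow> d \<in> RTF A \<Longrightarrow> c + d \<in> RTF A"
  using Poly_Mapping.keys_add[of c d] by (auto simp: RTF_def)

lemma RTF_scale: "c \<in> RTF A \<Longrightarrow> RTF_scale r c \<in> RTF A"
  by (fastforce simp: RTF_def in_keys_iff lookup_RTF_scale)

lemma RTF_sum: "(\<And>i. i \<in> I \<Longrightarrow> c i \<in> RTF A) \<Longrightarrow> (\<Sum>i\<in>I. c i) \<in> RTF A"
  by (induction I rule: infinite_finite_induct) (simp_all add: RTF_zero RTF_add)

lemma RTF_single: "T \<in> ttrees A \<Longrightarrow> Poly_Mapping.single T r \<in> RTF A"
  by (simp add: RTF_def)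

lemma RTF_lin: "c \<in> RTF A \<Longrightarrow> (\<And>T. T \<in> ttrees A \<Longrightarrow> h T \<in> RTF B) \<Longrightarrow> lin h c \<in> RTF B"
  unfolding lin_def by (intro RTF_sum RTF_scale) (auto simp: RTF_def)

lemma lin_cong_RTF:
  "c \<in> RTF A \<Longrightarrow> (\<And>T. T \<in> ttrees A \<Longrightarrow> h T = h' T) \<Longrightarrow> lin h c = lin h' c"
  by (intro lin_cong) (auto simp: RTF_def)

lemma RTF_act_lin: "RTF_act A s = lin (\<lambda>T. Poly_Mapping.single (relabel A s T) 1)"
  by (simp add: RTF_act_def lin_def RTF_scale_single fun_eq_iff)

lemma RTF_comp_lin: "RTF_comp v c d = lin (\<lambda>T. lin (tree_comp v T) d) c"
  by (simp add: RTF_comp_def lin_def RTF_scale_sum RTF_scale_scale)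

lemma module_carrier_RTF: "module_carrier RTF_scale (RTF A)"
  by unfold_locales
    (simp_all add: RTF_zero RTF_add RTF_scale RTF_scale_add_right RTF_scale_add_left RTF_scale_scale)

section \<open>The operad\<close>

text \<open>Conjugation by \<open>m\<close> and \<open>t\<close> matches the two function spaces.
  Restriction to \<open>J\<close> keeps the transported maps extensional, so that each attachment
  map is counted once.\<close>

lemma sum_PiE_reindex:
  assumes m: "bij_betw m I J" and t: "bij_betw t X Y"
  shows "(\<Sum>f\<in>J \<rightarrow>\<^sub>E Y. F f) = (\<Sum>g\<in>I \<rightarrow>\<^sub>E X. F (\<lambda>j\<in>J. t (g (inv_into I m j))))"
proof -
  have mI: "m i \<in> J" "inv_into I m (m i) = i" if "i \<in> I" for i
    using m that by (auto simp: bij_betw_def bij_betw_inv_into_left)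
  have mJ: "inv_into I m j \<in> I" "m (inv_into I m j) = j" if "j \<in> J" for j
    using m that bij_betw_inv_into_right[OF m] by (auto simp: bij_betw_def inv_into_into)
  have tX: "t x \<in> Y" "inv_into X t (t x) = x" if "x \<in> X" for x
    using t that by (auto simp: bij_betw_def bij_betw_inv_into_left)
  have tY: "inv_into X t y \<in> X" "t (inv_into X t y) = y" if "y \<in> Y" for y
    using t that bij_betw_inv_into_right[OF t] by (auto simp: bij_betw_def inv_into_into)
  show ?thesis
  proof (rule sum.reindex_bij_witness[where
        i = "\<lambda>g. \<lambda>j\<in>J. t (g (inv_into I m j))" and j = "\<lambda>f. \<lambda>i\<in>I. inv_into X t (f (m i))"])
    fix f assume f: "f \<in> J \<rightarrow>\<^sub>E Y"
    show eq: "(\<lambda>j\<in>J. t ((\<lambda>i\<in>I. inv_into X t (f (m i))) (inv_into I m j))) = f"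
      using f mJ tY by (fastforce simp: PiE_def Pi_def extensional_def fun_eq_iff)
    show "(\<lambda>i\<in>I. inv_into X t (f (m i))) \<in> I \<rightarrow>\<^sub>E X"
      using f mI tY by auto
    show "F (\<lambda>j\<in>J. t ((\<lambda>i\<in>I. inv_into X t (f (m i))) (inv_into I m j))) = F f"
      by (simp only: eq)
  next
    fix g assume g: "g \<in> I \<rightarrow>\<^sub>E X"
    show "(\<lambda>i\<in>I. inv_into X t ((\<lambda>j\<in>J. t (g (inv_into I m j))) (m i))) = g"
      using g mI tX by (fastforce simp: PiE_def Pi_def extensional_def fun_eq_iff)
    show "(\<lambda>j\<in>J. t (g (inv_into I m j))) \<in> J \<rightarrow>\<^sub>E Y"
      using g mJ tX by auto
  qed
qed

section \<open>Composition of basis trees\<close>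

lemma finite_maps: "finite A \<Longrightarrow> finite B \<Longrightarrow> T \<in> ttrees A \<Longrightarrow> finite (in_edges T v \<rightarrow>\<^sub>E B)"
  by (intro finite_PiE finite_in_edges) auto

lemma graftingI:
  "\<lbrakk>T \<in> ttrees A; U \<in> ttrees B; v \<in> A; disjnt (A - {v}) B; f \<in> in_edges T v \<rightarrow>\<^sub>E B\<rbrakk>
    \<Longrightarrow> grafting A B v f T U"
  by unfold_locales auto

lemma tree_comp_in_RTF:
  assumes "T \<in> ttrees A" "U \<in> ttrees B" "v \<in> A" "disjnt (A - {v}) B"
  shows "tree_comp v T U \<in> RTF (insertion A v B)"
  unfolding tree_comp_def using assms
  by (intro RTF_sum RTF_single grafting.graft_in_ttrees graftingI) (auto simp: verts_ttrees)

lemma lin_tree_comp: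
  "lin h (tree_comp v T U) = (\<Sum>f\<in>in_edges T v \<rightarrow>\<^sub>E verts U. h (graft v f T U))"
  by (simp add: tree_comp_def lin_sum lin_single)

lemma tree_comp_act:
  assumes fin: "finite A" and a: "a \<in> A" and disj: "disjnt (A - {a}) B"
    and s: "bij_betw s A A'" and t: "bij_betw t B B'" and disj': "disjnt (A' - {s a}) B'"
    and T: "T \<in> ttrees A'" and U: "U \<in> ttrees B'"
  shows "RTF_act (insertion A a B) (\<lambda>z. if z \<in> B then t z else s z) (tree_comp (s a) T U)
    = (tree_comp a (relabel A s T) (relabel B t U)
        :: ('a, 'w::ab_semigroup_mult) ttree \<Rightarrow>\<^sub>0 'k::{comm_ring,comm_monoid_mult})"
proof -
  interpret s: relabelling A A' s T using s T by unfold_locales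
  interpret t: relabelling B B' t U using t U by unfold_locales
  let ?\<sigma> = "\<lambda>z. if z \<in> B then t z else s z"
  have m: "bij_betw s (in_edges s.R a) (in_edges T (s a))" using a by (rule s.bij_betw_in_edges)
  have "RTF_act (insertion A a B) ?\<sigma> (tree_comp (s a) T U)
      = (\<Sum>f\<in>in_edges T (s a) \<rightarrow>\<^sub>E B'.
          Poly_Mapping.single (relabel (insertion A a B) ?\<sigma> (graft (s a) f T U)) (1::'k))"
    by (simp add: RTF_act_lin lin_tree_comp verts_ttrees[OF U])
  also have "\<dots> = (\<Sum>g\<in>in_edges s.R a \<rightarrow>\<^sub>E B. Poly_Mapping.single (relabel (insertion A a B) ?\<sigma>
      (graft (s a) (\<lambda>y\<in>in_edges T (s a). t (g (inv_into (in_edges s.R a) s y))) T U)) 1)"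
    by (rule sum_PiE_reindex[OF m t])
  also have "\<dots> = (\<Sum>g\<in>in_edges s.R a \<rightarrow>\<^sub>E B. Poly_Mapping.single (graft a g s.R t.R) 1)"
  proof (rule sum.cong[OF refl])
    fix g assume g: "g \<in> in_edges s.R a \<rightarrow>\<^sub>E B"
    show "Poly_Mapping.single (relabel (insertion A a B) ?\<sigma>
        (graft (s a) (\<lambda>y\<in>in_edges T (s a). t (g (inv_into (in_edges s.R a) s y))) T U)) 1
      = Poly_Mapping.single (graft a g s.R t.R) (1::'k)"
      using g m
      by (subst relabel_graft[OF fin a disj s t disj' T U, where f = g])
        (auto simp: bij_betw_inv_into_left[OF m] bij_betw_apply)
  qed
  finally show ?thesis by (simp add: tree_comp_def verts_ttrees[OF t.relabel_in_ttrees])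
qed

lemma tree_comp_nested:
  assumes fin: "finite A" "finite B" "finite C" and a: "a \<in> A" and b: "b \<in> B"
    and disj: "disjnt (A - {a}) B" "disjnt (A - {a}) C" "disjnt (B - {b}) C"
    and T: "T \<in> ttrees A" and U: "U \<in> ttrees B" and V: "V \<in> ttrees C"
  shows "lin (\<lambda>W. tree_comp b W V) (tree_comp a T U)
    = (lin (tree_comp a T) (tree_comp b U V)
        :: ('a, 'w::ab_semigroup_mult) ttree \<Rightarrow>\<^sub>0 'k::{comm_ring,comm_monoid_mult})"
proof -
  let ?I = "in_edges T a" and ?J = "in_edges U b" and ?BC = "insertion B b C"
  let ?F = "?I \<rightarrow>\<^sub>E B"
  let ?X = "\<lambda>f. in_edges (graft a f T U) b \<rightarrow>\<^sub>E C"
  have G: "grafting A B a f T U" if "f \<in> ?F" for f using that T U a disj by (intro graftingI)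
  have H: "grafting B C b h U V" if "h \<in> ?J \<rightarrow>\<^sub>E C" for h using that U V b disj by (intro graftingI)
  have In: "in_edges (graft a f T U) b = ?J \<union> {x \<in> ?I. f x = b}" if "f \<in> ?F" for f
    using grafting.in_edges_G_B[OF G[OF that] b] .
  \<comment> \<open>Edges of \<open>T\<close> and of \<open>U\<close> have distinct names even if
    \<open>a\<close> lies in \<open>B\<close>, because \<open>a\<close> itself is not an edge
    entering \<open>a\<close>.\<close>
  have IJ: "x \<notin> ?J" if "x \<in> ?I" for x
    using that in_edges_subset[OF T, of a] in_edges_subset[OF U, of b] disj(1) unfolding disjnt_def by blast
  have finX: "finite (?X f)" if "f \<in> ?F" for f
    using finite_maps[OF _ fin(3) grafting.graft_in_ttrees[OF G[OF that]]] fin by simp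
  have BC: "y \<in> C \<Longrightarrow> y \<in> B \<Longrightarrow> y = b" for y using disj(3) by (auto simp: disjnt_def)
  define \<phi> where "\<phi> = (\<lambda>(f, g). (restrict g ?J, \<lambda>x\<in>?I. if f x = b then g x else f x))"
  \<comment> \<open>From \<open>k\<close> the map \<open>f\<close> is recovered by contracting
    \<open>C\<close> to \<open>b\<close>: the only possible common label of \<open>B\<close> and
    \<open>C\<close> is \<open>b\<close>, so \<open>k x\<close> lies in \<open>C\<close> exactly
    when \<open>f x = b\<close>. Then \<open>g\<close> is \<open>h\<close> on the edges of
    \<open>U\<close> and \<open>k\<close> on the edges of \<open>T\<close> sent into
    \<open>C\<close>.\<close>
  define \<psi> where "\<psi> = (\<lambda>(h, k). (\<lambda>x\<in>?I. if k x \<in> C then b else k x,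
    \<lambda>x\<in>?J \<union> {x \<in> ?I. k x \<in> C}. if x \<in> ?J then h x else k x))"
  have "lin (\<lambda>W. tree_comp b W V) (tree_comp a T U)
      = (\<Sum>f\<in>?F. \<Sum>g\<in>?X f. Poly_Mapping.single (graft b g (graft a f T U) V) (1::'k))"
    by (simp add: lin_tree_comp verts_ttrees[OF U]) (simp add: tree_comp_def verts_ttrees[OF V])
  \<comment> \<open>The domain of \<open>g\<close> depends on \<open>f\<close>, hence a dependent
    sum. On the other side the choices of \<open>h\<close> and \<open>k\<close> are independent and
    range over a product.\<close>
  also have "\<dots> = (\<Sum>(f, g)\<in>Sigma ?F ?X. Poly_Mapping.single (graft b g (graft a f T U) V) 1)"
    using finite_maps[OF fin(1,2) T] finX by (intro sum.Sigma) auto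
  also have "\<dots> = (\<Sum>(h, k)\<in>(?J \<rightarrow>\<^sub>E C) \<times> (?I \<rightarrow>\<^sub>E ?BC).
      Poly_Mapping.single (graft a k T (graft b h U V)) 1)"
  proof (rule sum.reindex_bij_witness[where i = \<psi> and j = \<phi>])
    fix p assume "p \<in> Sigma ?F ?X"
    then obtain f g where p: "p = (f, g)" and f: "f \<in> ?F" and g: "g \<in> ?X f" by auto
    have gC: "g x \<in> C" if "x \<in> ?J \<or> x \<in> ?I \<and> f x = b" for x
      using g In[OF f] that by auto
    have fB: "f x \<in> B" if "x \<in> ?I" for x using f that by auto
    let ?h = "restrict g ?J" and ?k = "\<lambda>x\<in>?I. if f x = b then g x else f x"
    have \<phi>: "\<phi> p = (?h, ?k)" by (simp add: p \<phi>_def)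
    have kC: "?k x \<in> C \<longleftrightarrow> f x = b" if "x \<in> ?I" for x
      using that gC fB BC by auto
    show "\<psi> (\<phi> p) = p"
    proof -
      have "(\<lambda>x\<in>?I. if ?k x \<in> C then b else ?k x) = f"
      proof
        fix x show "(\<lambda>x\<in>?I. if ?k x \<in> C then b else ?k x) x = f x"
          using kC[of x] f by (cases "x \<in> ?I") (auto simp: PiE_arb[OF f])
      qed
      moreover have "{x \<in> ?I. ?k x \<in> C} = {x \<in> ?I. f x = b}"
        using kC by (intro Collect_cong conj_cong refl)
      moreover have "(\<lambda>x\<in>?J \<union> {x \<in> ?I. f x = b}. if x \<in> ?J then ?h x else ?k x) = g"
      proof
        fix x show "(\<lambda>x\<in>?J \<union> {x \<in> ?I. f x = b}. if x \<in> ?J then ?h x else ?k x) x = g x"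
          using PiE_arb[OF g, of x] by (auto simp: In[OF f])
      qed
      ultimately show ?thesis unfolding \<phi> by (simp add: \<psi>_def p)
    qed
    show "\<phi> p \<in> (?J \<rightarrow>\<^sub>E C) \<times> (?I \<rightarrow>\<^sub>E ?BC)"
      unfolding \<phi> using gC fB by auto
    interpret nested_grafting A B C a b f g ?h ?k T U V
      using fin T U V a b disj fB g gC by unfold_locales auto
    show "(case \<phi> p of (h, k) \<Rightarrow> Poly_Mapping.single (graft a k T (graft b h U V)) 1)
        = (case p of (f, g) \<Rightarrow> Poly_Mapping.single (graft b g (graft a f T U) V) (1::'k))"
      unfolding \<phi> unfolding p by (simp add: graft_nested)
  next
    fix q assume "q \<in> (?J \<rightarrow>\<^sub>E C) \<times> (?I \<rightarrow>\<^sub>E ?BC)"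
    then obtain h k where q: "q = (h, k)" and h: "h \<in> ?J \<rightarrow>\<^sub>E C" and k: "k \<in> ?I \<rightarrow>\<^sub>E ?BC" by auto
    have kBC: "k x \<in> B \<and> k x \<noteq> b" if "x \<in> ?I" "k x \<notin> C" for x
      using k that by auto
    have hC: "h x \<in> C" if "x \<in> ?J" for x using h that by auto
    let ?f = "\<lambda>x\<in>?I. if k x \<in> C then b else k x"
    let ?K = "?J \<union> {x \<in> ?I. k x \<in> C}"
    let ?g = "\<lambda>x\<in>?K. if x \<in> ?J then h x else k x"
    have \<psi>: "\<psi> q = (?f, ?g)" by (simp add: q \<psi>_def)
    have fb: "?f x = b \<longleftrightarrow> k x \<in> C" if "x \<in> ?I" for x
      using that kBC by auto
    have f: "?f \<in> ?F" using b kBC by auto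
    have "in_edges (graft a ?f T U) b = ?K"
      using fb by (auto simp: In[OF f] split: if_splits)
    then show "\<psi> q \<in> Sigma ?F ?X"
      using f hC unfolding \<psi> by auto
    have "restrict ?g ?J = h"
    proof
      fix x show "restrict ?g ?J x = h x"
        using PiE_arb[OF h, of x] by auto
    qed
    moreover have "(\<lambda>x\<in>?I. if ?f x = b then ?g x else ?f x) = k"
    proof
      fix x show "(\<lambda>x\<in>?I. if ?f x = b then ?g x else ?f x) x = k x"
        using fb[of x] IJ[of x] PiE_arb[OF k, of x] by auto
    qed
    ultimately show "\<phi> (\<psi> q) = q" unfolding \<psi> by (simp add: \<phi>_def q)
  qed
  also have "\<dots> = (\<Sum>h\<in>?J \<rightarrow>\<^sub>E C. \<Sum>k\<in>?I \<rightarrow>\<^sub>E ?BC.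
      Poly_Mapping.single (graft a k T (graft b h U V)) 1)"
    by (rule sum.cartesian_product[symmetric])
  also have "\<dots> = lin (tree_comp a T) (tree_comp b U V)"
    by (simp add: lin_tree_comp verts_ttrees[OF V])
      (simp add: tree_comp_def grafting.verts_G[OF H])
  finally show ?thesis .
qed

text \<open>The inner sum runs over maps on the renamed edges entering \<open>a'\<close>, a set that
  involves \<open>f\<close>. Pulling back along the renaming makes it range over maps on
  In(\<open>a'\<close>) in \<open>T\<close> itself, so that both orders of insertion become double
  sums over the same pairs.\<close>

lemma lin_tree_comp_parallel:
  assumes T: "T \<in> ttrees A" and U: "U \<in> ttrees B" and V: "V \<in> ttrees C"
    and a: "a \<in> A" and a': "a' \<in> A" "a \<noteq> a'" and disj: "disjnt (A - {a}) B"
  shows "lin (\<lambda>W. tree_comp a' W V) (tree_comp a T U)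
    = (\<Sum>f\<in>in_edges T a \<rightarrow>\<^sub>E B. \<Sum>g\<in>in_edges T a' \<rightarrow>\<^sub>E C.
        Poly_Mapping.single (graft a' (\<lambda>y\<in>in_edges (graft a f T U) a'.
          g (inv_into (in_edges T a') (\<lambda>x. if x = a then root U else x) y)) (graft a f T U) V)
          (1::'k::{comm_ring,comm_monoid_mult}))"
    and "f \<in> in_edges T a \<rightarrow>\<^sub>E B \<Longrightarrow>
      bij_betw (\<lambda>x. if x = a then root U else x) (in_edges T a') (in_edges (graft a f T U) a')"
proof -
  let ?m = "\<lambda>x. if x = a then root U else x"
  show bij: "bij_betw ?m (in_edges T a') (in_edges (graft a f T U) a')"
    if f: "f \<in> in_edges T a \<rightarrow>\<^sub>E B" for f
  proof -
    interpret grafting A B a f T U using T U a disj f by (rule graftingI)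
    have "x \<noteq> root U" if "x \<in> in_edges T a'" "x \<noteq> a" for x
      using that in_edges_subset[OF T, of a'] notin_B[of x] root_in[OF U] by auto
    then have "inj_on ?m (in_edges T a')" by (auto simp: inj_on_def)
    then show ?thesis using a' by (simp add: bij_betw_def in_edges_G_A)
  qed
  have "lin (\<lambda>W. tree_comp a' W V) (tree_comp a T U)
    = (\<Sum>f\<in>in_edges T a \<rightarrow>\<^sub>E B. \<Sum>g\<in>in_edges (graft a f T U) a' \<rightarrow>\<^sub>E C.
        Poly_Mapping.single (graft a' g (graft a f T U) V) (1::'k))"
    by (simp add: lin_tree_comp verts_ttrees[OF U]) (simp add: tree_comp_def verts_ttrees[OF V])
  also have "\<dots> = (\<Sum>f\<in>in_edges T a \<rightarrow>\<^sub>E B. \<Sum>g\<in>in_edges T a' \<rightarrow>\<^sub>E C.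
        Poly_Mapping.single (graft a' (\<lambda>y\<in>in_edges (graft a f T U) a'.
          g (inv_into (in_edges T a') ?m y)) (graft a f T U) V) 1)"
    by (intro sum.cong[OF refl] sum_PiE_reindex[OF bij bij_betw_id, unfolded id_apply])
  finally show "lin (\<lambda>W. tree_comp a' W V) (tree_comp a T U) = \<dots>" .
qed

lemma tree_comp_parallel:
  assumes fin: "finite A" and a: "a \<in> A" and a': "a' \<in> A" and neq: "a \<noteq> a'"
    and disj: "disjnt (A - {a}) B" "disjnt (A - {a'}) C" "disjnt B C"
    and T: "T \<in> ttrees A" and U: "U \<in> ttrees B" and V: "V \<in> ttrees C"
  shows "lin (\<lambda>W. tree_comp a' W V) (tree_comp a T U)
    = (lin (\<lambda>W. tree_comp a W U) (tree_comp a' T V)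
        :: ('a, 'w::ab_semigroup_mult) ttree \<Rightarrow>\<^sub>0 'k::{comm_ring,comm_monoid_mult})"
proof -
  let ?I = "in_edges T a" and ?I' = "in_edges T a'"
  let ?m = "\<lambda>x. if x = a then root U else x" and ?m' = "\<lambda>x. if x = a' then root V else x"
  note L = lin_tree_comp_parallel[OF T U V a a' neq disj(1)]
  note R = lin_tree_comp_parallel[OF T V U a' a neq[symmetric] disj(2)]
  have "graft a' (\<lambda>y\<in>in_edges (graft a f T U) a'. g (inv_into ?I' ?m y)) (graft a f T U) V
      = graft a (\<lambda>y\<in>in_edges (graft a' g T V) a. f (inv_into ?I ?m' y)) (graft a' g T V) U"
    if f: "f \<in> ?I \<rightarrow>\<^sub>E B" and g: "g \<in> ?I' \<rightarrow>\<^sub>E C" for f g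
  proof -
    note m = L(2)[OF f] and m' = R(2)[OF g]
    show ?thesis
    proof (rule parallel_grafting.graft_parallel[of A B C a a' f g], unfold_locales)
      fix x
      show "(\<lambda>y\<in>in_edges (graft a f T U) a'. g (inv_into ?I' ?m y)) (?m x) = g x" if "x \<in> ?I'"
        using bij_betw_apply[OF m that] bij_betw_inv_into_left[OF m that] by simp
      show "(\<lambda>y\<in>in_edges (graft a' g T V) a. f (inv_into ?I ?m' y)) (?m' x) = f x" if "x \<in> ?I"
        using bij_betw_apply[OF m' that] bij_betw_inv_into_left[OF m' that] by simp
    qed (use fin T U V a a' neq disj f g in auto)
  qed
  \<comment> \<open>After exchanging the two sums the terms agree for each pair of attachment
    maps.\<close>
  then show ?thesis
    unfolding L(1) R(1) by (subst sum.swap) (intro sum.cong refl arg_cong2[where f = Poly_Mapping.single])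
qed

section \<open>The species and the operad laws\<close>

lemma species_RTF:
  "species (RTF_scale :: 'k::{comm_ring,comm_monoid_mult} \<Rightarrow> (('a, 'w) ttree \<Rightarrow>\<^sub>0 'k) \<Rightarrow> _) RTF RTF_act"
proof (rule species.intro)
  fix A B C :: "'a set" and s s' t :: "'a \<Rightarrow> 'a" and x y :: "('a, 'w) ttree \<Rightarrow>\<^sub>0 'k" and r :: 'k
  show "module_carrier RTF_scale (RTF A :: (('a, 'w) ttree \<Rightarrow>\<^sub>0 'k) set)"
    by (rule module_carrier_RTF)
  show "RTF_act A s (x + y) = RTF_act A s x + RTF_act A s y"
    by (simp add: RTF_act_lin lin_add)
  show "RTF_act A s (RTF_scale r x) = RTF_scale r (RTF_act A s x)"
    by (simp add: RTF_act_lin lin_scale)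
  show "RTF_act A s x \<in> RTF A" if "bij_betw s A B" "x \<in> RTF B"
    unfolding RTF_act_lin using that
    by (intro RTF_lin[OF that(2)] RTF_single relabelling.relabel_in_ttrees relabelling.intro)
  show "RTF_act A s x = RTF_act A s' x" if "\<And>z. z \<in> A \<Longrightarrow> s z = s' z"
    by (simp add: RTF_act_lin relabel_cong[of A s s'] that)
  show "RTF_act A id x = x" if "x \<in> RTF A"
    unfolding RTF_act_lin using lin_cong_RTF[OF that] relabel_id lin_ident by (metis (lifting))
  show "RTF_act A (t \<circ> s) x = RTF_act A s (RTF_act B t x)"
    if "bij_betw s A B" "bij_betw t B C" "x \<in> RTF C"
    unfolding RTF_act_lin lin_lin lin_single RTF_scale_one
    using that by (intro lin_cong_RTF[OF that(3)]) (simp add: relabel_comp)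
qed

theorem proposition4p7:
  shows "operad
    (RTF_scale :: 'k::{comm_ring,comm_monoid_mult} \<Rightarrow>
       (('a, 'w::ab_semigroup_mult) ttree \<Rightarrow>\<^sub>0 'k) \<Rightarrow> (('a, 'w) ttree \<Rightarrow>\<^sub>0 'k))
    RTF RTF_act (\<lambda>A v B. RTF_comp v) RTF_unit"
proof (intro operad.intro species_RTF operad_axioms.intro)
  fix A A' B B' C :: "'a set" and a a' b v w :: 'a and s t :: "'a \<Rightarrow> 'a"
    and x x' y y' z :: "('a, 'w) ttree \<Rightarrow>\<^sub>0 'k" and r :: 'k
  show "RTF_comp a x y \<in> RTF (insertion A a B)"
    if "a \<in> A" "disjnt (A - {a}) B" "x \<in> RTF A" "y \<in> RTF B"
    unfolding RTF_comp_lin using that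
    by (intro RTF_lin[OF that(3)] RTF_lin[OF that(4)] tree_comp_in_RTF)
  show "RTF_comp a (x + x') y = RTF_comp a x y + RTF_comp a x' y"
    by (simp add: RTF_comp_lin lin_add)
  show "RTF_comp a x (y + y') = RTF_comp a x y + RTF_comp a x y'"
    by (simp add: RTF_comp_lin lin_add lin_add_fun)
  show "RTF_comp a (RTF_scale r x) y = RTF_scale r (RTF_comp a x y)"
    by (simp add: RTF_comp_lin lin_scale)
  show "RTF_comp a x (RTF_scale r y) = RTF_scale r (RTF_comp a x y)"
    by (simp add: RTF_comp_lin lin_scale lin_scale_fun)
  show "RTF_act (insertion A a B) (\<lambda>z. if z \<in> B then t z else s z) (RTF_comp (s a) x y)
      = RTF_comp a (RTF_act A s x) (RTF_act B t y)"
    if "finite A" "a \<in> A" "disjnt (A - {a}) B" "bij_betw s A A'" "bij_betw t B B'"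
      "disjnt (A' - {s a}) B'" and x: "x \<in> RTF A'" and y: "y \<in> RTF B'"
  proof -
    let ?act = "RTF_act (insertion A a B) (\<lambda>z. if z \<in> B then t z else s z)"
    have "?act (RTF_comp (s a) x y) = lin (\<lambda>T. lin (\<lambda>U. ?act (tree_comp (s a) T U)) y) x"
      unfolding RTF_comp_lin RTF_act_lin lin_lin ..
    also have "\<dots> = lin (\<lambda>T. lin (\<lambda>U. tree_comp a (relabel A s T) (relabel B t U)) y) x"
      using that by (intro lin_cong_RTF[OF x] lin_cong_RTF[OF y] tree_comp_act)
    also have "\<dots> = RTF_comp a (RTF_act A s x) (RTF_act B t y)"
      unfolding RTF_comp_lin RTF_act_lin lin_lin lin_single RTF_scale_one ..
    finally show ?thesis .
  qed
  \<comment> \<open>Moving the sum over \<open>z\<close> outside the sum over the trees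
    \<open>W\<close> leaves an innermost expression with fixed basis trees \<open>T\<close>,
    \<open>U\<close> and \<open>V\<close>, to which the tree identities apply.\<close>
  have comp_comp: "RTF_comp a (RTF_comp b x y) z
      = lin (\<lambda>T. lin (\<lambda>U. lin (\<lambda>V. lin (\<lambda>W. tree_comp a W V) (tree_comp b T U)) z) y) x"
    for a b and x y z :: "('a, 'w) ttree \<Rightarrow>\<^sub>0 'k"
    unfolding RTF_comp_lin lin_lin lin_swap[where h = "tree_comp a" and d = z and c = "tree_comp b T U" for T U] ..
  show "RTF_comp b (RTF_comp a x y) z = RTF_comp a x (RTF_comp b y z)"
    if "finite A" "finite B" "finite C" "a \<in> A" "b \<in> B"
      "disjnt (A - {a}) B" "disjnt (A - {a}) C" "disjnt (B - {b}) C"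
      and x: "x \<in> RTF A" and y: "y \<in> RTF B" and z: "z \<in> RTF C"
  proof -
    have "RTF_comp b (RTF_comp a x y) z
        = lin (\<lambda>T. lin (\<lambda>U. lin (\<lambda>V. lin (tree_comp a T) (tree_comp b U V)) z) y) x"
      unfolding comp_comp using that
      by (intro lin_cong_RTF[OF x] lin_cong_RTF[OF y] lin_cong_RTF[OF z] tree_comp_nested)
    then show ?thesis unfolding RTF_comp_lin lin_lin .
  qed
  show "RTF_comp a' (RTF_comp a x y) z = RTF_comp a (RTF_comp a' x z) y"
    if "finite A" "a \<in> A" "a' \<in> A" "a \<noteq> a'"
      "disjnt (A - {a}) B" "disjnt (A - {a'}) C" "disjnt B C"
      and x: "x \<in> RTF A" and y: "y \<in> RTF B" and z: "z \<in> RTF C"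
  proof -
    have "RTF_comp a' (RTF_comp a x y) z
        = lin (\<lambda>T. lin (\<lambda>U. lin (\<lambda>V. lin (\<lambda>W. tree_comp a W U) (tree_comp a' T V)) z) y) x"
      unfolding comp_comp using that
      by (intro lin_cong_RTF[OF x] lin_cong_RTF[OF y] lin_cong_RTF[OF z] tree_comp_parallel)
    \<comment> \<open>The other composite expands with the sums over \<open>y\<close> and
      \<open>z\<close> in the opposite order.\<close>
    also have "\<dots> = RTF_comp a (RTF_comp a' x z) y"
      unfolding comp_comp by (intro lin_cong lin_swap)
    finally show ?thesis .
  qed
  have unit_verts: "verts (TTree v (\<lambda>_. None)) = {v}" for v :: 'a
    by (simp add: verts_def)
  show "RTF_unit v \<in> (RTF {v} :: (('a, 'w) ttree \<Rightarrow>\<^sub>0 'k) set)"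
    by (simp add: RTF_unit_def RTF_single single_vertex_in_ttrees)
  show "RTF_act {v} (\<lambda>_. w) (RTF_unit w) = (RTF_unit v :: ('a, 'w) ttree \<Rightarrow>\<^sub>0 'k)"
  proof -
    have "relabel {v} (\<lambda>_. w) (TTree w (\<lambda>_. None)) = (TTree v (\<lambda>_. None) :: ('a, 'w) ttree)"
      by (rule relabel_unique[of _ _ "{w}"]) (simp_all add: single_vertex_in_ttrees bij_betw_def)
    then show ?thesis by (simp add: RTF_unit_def RTF_act_lin lin_single)
  qed
  show "RTF_comp v (RTF_unit v) y = y" if y: "y \<in> RTF B"
  proof -
    have "tree_comp v (TTree v (\<lambda>_. None)) U = Poly_Mapping.single U (1::'k)" if "U \<in> ttrees B" for U :: "('a, 'w) ttree"
      using graft_single_vertex_left[OF that]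
      by (simp add: tree_comp_def in_edges_def par_rel_single_vertex)
    then have "lin (tree_comp v (TTree v (\<lambda>_. None))) y = lin (\<lambda>U. Poly_Mapping.single U 1) y"
      by (intro lin_cong_RTF[OF y])
    then show ?thesis by (simp add: RTF_comp_lin RTF_unit_def lin_single lin_ident)
  qed
  show "RTF_comp b y (RTF_unit v) = RTF_act (insertion B b {v}) (\<lambda>z. if z = v then b else z) y"
    if b: "b \<in> B" "disjnt (B - {b}) {v}" and y: "y \<in> RTF B"
  proof -
    have "tree_comp b T (TTree v (\<lambda>_. None))
        = Poly_Mapping.single (relabel (insertion B b {v}) (\<lambda>z. if z = v then b else z) T) (1::'k)"
      if T: "T \<in> ttrees B" for T :: "('a, 'w) ttree"
    proof -
      \<comment> \<open>With a single target vertex there is exactly one attachment map, so the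
        composition sum has one term.\<close>
      have "in_edges T b \<rightarrow>\<^sub>E {v} = {\<lambda>x\<in>in_edges T b. v}"
        using PiE_singleton[of "\<lambda>x\<in>in_edges T b. v" "in_edges T b"] by (simp cong: PiE_cong)
      then show ?thesis
        using graft_single_vertex_right[OF T b, of "\<lambda>x\<in>in_edges T b. v"]
        by (simp add: tree_comp_def unit_verts)
    qed
    then show ?thesis
      unfolding RTF_comp_lin RTF_unit_def lin_single RTF_scale_one RTF_act_lin
      by (intro lin_cong_RTF[OF y])
  qed
qed

end
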